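(* Let $d\ge 14$ be an integer. There exists a probability distribution $\pi$ on $\{1,2,3,\ldots\}$ (that is, giving at least one particle almost surely) with infinite mean such that the frog model on the $(d+1)$-regular tree $\mathbf{T}_d$, started from the root $\rho$ with i.i.d.-$\pi$ initial conditions, is almost surely transient.
   Context: $\mathbf{T}_d$ denotes the infinite $(d+1)$-regular tree, with a designated vertex $\rho$ called the root. Frog model with i.i.d.-$\pi$ initial conditions on $\mathbf{T}_d$: initially $\rho$ contains one active particle, and every other vertex $v$ contains $\eta(v)$ sleeping particles, where the $\eta(v)$ are i.i.d. with distribution $\pi$. Active particles perform independent simple random walks on $\mathbf{T}_d$ in discrete time (independent also of $\eta$); sleeping particles do not move. When an active particle visits a vertex, all sleeping particles there become active, and they then perform their own independent simple random walks from that vertex. Particles never fall back asleep. A realization of the frog model is called recurrent if the starting vertex $\rho$ is visited infinitely often by particles (counting the visits of all particles over all time), and transient otherwise. *)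

theory Defs
  imports "HOL-Probability.Probability"
begin

section \<open>The regular tree\<close>

text \<open>
  The (d+1)-regular tree, rooted at the empty list: the parent of \<open>k # v\<close> is \<open>v\<close>, the root has
  the d+1 children \<open>[0], ..., [d]\<close>, and every other vertex has d children.
\<close>

fun is_vertex :: "nat \<Rightarrow> nat list \<Rightarrow> bool" where
  "is_vertex d [] \<longleftrightarrow> True"
| "is_vertex d [k] \<longleftrightarrow> k \<le> d"
| "is_vertex d (k # x # v) \<longleftrightarrow> k < d \<and> is_vertex d (x # v)"

definition vertices :: "nat \<Rightarrow> nat list set" where
  "vertices d = {v. is_vertex d v}"

abbreviation tree_root :: "nat list" where
  "tree_root \<equiv> []"

definition adjacent :: "nat list \<Rightarrow> nat list \<Rightarrow> bool" where
  "adjacent u v \<longleftrightarrow> (\<exists>k. u = k # v) \<or> (\<exists>k. v = k # u)"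

definition neighbours :: "nat \<Rightarrow> nat list \<Rightarrow> nat list set" where
  "neighbours d v = {u \<in> vertices d. adjacent v u}"

text \<open>
  An enumeration of the neighbours of a vertex by \<open>{0..d}\<close>: away from the root, the index d stands
  for the parent. Feeding it i.i.d. uniform indices therefore produces simple random walk; this is
  what \<open>simple_random_walk_step\<close> below records.
\<close>

fun neighbour :: "nat \<Rightarrow> nat list \<Rightarrow> nat \<Rightarrow> nat list" where
  "neighbour d [] k = [k]"
| "neighbour d (x # v) k = (if k = d then v else k # x # v)"

lemma is_vertex_ConsD: "is_vertex d (x # v) \<Longrightarrow> is_vertex d v"
  by (cases v) auto

lemma bij_betw_neighbour:
  assumes "v \<in> vertices d"
  shows "bij_betw (neighbour d v) {0..d} (neighbours d v)"
proof (cases v)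
  case Nil
  have "neighbours d [] = (\<lambda>k. [k]) ` {0..d}"
    by (auto simp: neighbours_def vertices_def adjacent_def)
  then show ?thesis
    using Nil by (auto simp: bij_betw_def inj_on_def)
next
  case (Cons x w)
  have w: "is_vertex d w" and xw: "is_vertex d (x # w)"
    using assms Cons is_vertex_ConsD by (auto simp: vertices_def)
  have "inj_on (neighbour d (x # w)) {0..d}"
    by (auto simp: inj_on_def split: if_splits dest: arg_cong[where f = length])
  moreover have "neighbour d (x # w) ` {0..d} = neighbours d (x # w)"
  proof
    show "neighbour d (x # w) ` {0..d} \<subseteq> neighbours d (x # w)"
      using w xw by (auto simp: neighbours_def vertices_def adjacent_def)
    show "neighbours d (x # w) \<subseteq> neighbour d (x # w) ` {0..d}"
    proof
      fix u assume "u \<in> neighbours d (x # w)"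
      then have "u = w \<or> (\<exists>k<d. u = k # x # w)"
        by (auto simp: neighbours_def vertices_def adjacent_def)
      then show "u \<in> neighbour d (x # w) ` {0..d}"
      proof
        assume "u = w"
        then have "u = neighbour d (x # w) d" by simp
        then show ?thesis by (intro image_eqI) auto
      next
        assume "\<exists>k<d. u = k # x # w"
        then obtain k where "k < d" "u = k # x # w" by blast
        then show ?thesis by (intro image_eqI[of _ _ k]) auto
      qed
    qed
  qed
  ultimately show ?thesis
    using Cons by (simp add: bij_betw_def)
qed

lemma card_neighbours:
  assumes "v \<in> vertices d"
  shows "card (neighbours d v) = d + 1"
  using bij_betw_same_card[OF bij_betw_neighbour[OF assms]] by simp

lemma simple_random_walk_step:
  assumes "v \<in> vertices d"
  shows "map_pmf (neighbour d v) (pmf_of_set {0..d}) = pmf_of_set (neighbours d v)"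
  by (rule map_pmf_of_set_bij_betw[OF bij_betw_neighbour[OF assms]]) auto


section \<open>The frog model\<close>

text \<open>
  The particle \<open>(v, i)\<close> is the i-th particle initially located at the vertex v, for \<open>i < \<eta> v\<close>;
  the root carries the single particle \<open>(tree_root, 0)\<close> irrespective of \<open>\<eta> tree_root\<close>.
\<close>

type_synonym particle = "nat list \<times> nat"

text \<open>
  \<open>U (p, n)\<close> is the index of the neighbour to which the particle p jumps in the (n+1)-st step
  after it has been woken up, and \<open>walk d U p n\<close> is its position after n such steps.
\<close>

primrec walk :: "nat \<Rightarrow> (particle \<times> nat \<Rightarrow> nat) \<Rightarrow> particle \<Rightarrow> nat \<Rightarrow> nat list" where
  "walk d U p 0 = fst p"
| "walk d U p (Suc n) = neighbour d (walk d U p n) (U (p, n))"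

text \<open>
  The state at time t consists of the set of active particles and of the number of steps that each
  particle has made so far (0 for a sleeping particle).
\<close>

primrec frog_state ::
  "nat \<Rightarrow> (nat list \<Rightarrow> nat) \<Rightarrow> (particle \<times> nat \<Rightarrow> nat) \<Rightarrow> nat \<Rightarrow> particle set \<times> (particle \<Rightarrow> nat)"
where
  "frog_state d \<eta> U 0 = ({(tree_root, 0)}, \<lambda>_. 0)"
| "frog_state d \<eta> U (Suc t) =
    (let A = fst (frog_state d \<eta> U t);
         s = snd (frog_state d \<eta> U t);
         s' = (\<lambda>p. if p \<in> A then Suc (s p) else s p)
     in (A \<union> {(v, i). v \<noteq> tree_root \<and> i < \<eta> v \<and> (\<exists>q\<in>A. walk d U q (s' q) = v)}, s'))"

definition active ::
  "nat \<Rightarrow> (nat list \<Rightarrow> nat) \<Rightarrow> (particle \<times> nat \<Rightarrow> nat) \<Rightarrow> nat \<Rightarrow> particle set" where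
  "active d \<eta> U t = fst (frog_state d \<eta> U t)"

definition location ::
  "nat \<Rightarrow> (nat list \<Rightarrow> nat) \<Rightarrow> (particle \<times> nat \<Rightarrow> nat) \<Rightarrow> nat \<Rightarrow> particle \<Rightarrow> nat list" where
  "location d \<eta> U t p = walk d U p (snd (frog_state d \<eta> U t) p)"

definition root_visits ::
  "nat \<Rightarrow> (nat list \<Rightarrow> nat) \<Rightarrow> (particle \<times> nat \<Rightarrow> nat) \<Rightarrow> (particle \<times> nat) set" where
  "root_visits d \<eta> U = {(p, t). p \<in> active d \<eta> U t \<and> location d \<eta> U t p = tree_root}"

definition recurrent ::
  "nat \<Rightarrow> (nat list \<Rightarrow> nat) \<Rightarrow> (particle \<times> nat \<Rightarrow> nat) \<Rightarrow> bool" where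
  "recurrent d \<eta> U \<longleftrightarrow> infinite (root_visits d \<eta> U)"

definition transient ::
  "nat \<Rightarrow> (nat list \<Rightarrow> nat) \<Rightarrow> (particle \<times> nat \<Rightarrow> nat) \<Rightarrow> bool" where
  "transient d \<eta> U \<longleftrightarrow> \<not> recurrent d \<eta> U"

definition frog_space ::
  "nat \<Rightarrow> nat pmf \<Rightarrow> ((nat list \<Rightarrow> nat) \<times> (particle \<times> nat \<Rightarrow> nat)) measure" where
  "frog_space d \<pi> =
    (\<Pi>\<^sub>M v\<in>vertices d. measure_pmf \<pi>) \<Otimes>\<^sub>M
    (\<Pi>\<^sub>M j\<in>(vertices d \<times> UNIV) \<times> UNIV. measure_pmf (pmf_of_set {0..d}))"

end

theory Submission
  imports Defs "HOL-Library.Sublist" "HOL-Library.Transitive_Closure_Table"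
begin

text \<open>
  The initial distribution \<open>frog_pmf d\<close> is heavy-tailed: a vertex carries \<open>d ^ m\<close> particles with
  probability of order \<open>d powr (- m)\<close>, which makes the mean infinite, but its truncated means
  \<open>E (min 1 (\<eta> / d ^ j))\<close> are at most \<open>(101 / 100) * b ^ j\<close> for some b between \<open>1 / d\<close> and
  \<open>1 / sqrt d\<close>. These truncated means are what matters: a walk on the tree reaches a
  given vertex at distance j with probability at most \<open>1 / d ^ j\<close>, so the particles of one vertex u reach a given v at distance j with probability
  at most \<open>min 1 (\<eta> u / d ^ j)\<close>. However many particles u carries, they can do no more than wake up v, and
  this is why an infinite mean is harmless.

  Call it a hop from u to v when some particle that starts at u visits v. Hops from distinct vertices
  are independent, and a hop over distance j has probability at most \<open>(101 / 100) * b ^ j\<close>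
  (\<open>truncated_mean_le\<close>). If a particle that starts at v is ever active and visits the root, then there
  is a self-avoiding path of hops from the root to v, followed by a hop from v to the root
  (\<open>active_reachable\<close>, \<open>closed_path_through\<close>). By independence, the probability that such a path is
  realised is at most the product of its hop bounds (\<open>prob_closed_path\<close>).

  These products have a finite sum over all paths. Weigh a vertex v by \<open>r ^ length v\<close> with
  \<open>r = 1 / sqrt d\<close>. Summing \<open>b ^ dist u v\<close> against this weight over all \<open>v \<noteq> u\<close> multiplies the weight of u by at
  most \<open>1 / (1 - x)\<^sup>2 - 1\<close>, where \<open>x = b * sqrt d\<close>: a geodesic goes up for a while, each step costing
  \<open>b / r = x\<close>, and then goes down, each step costing \<open>d * b * r = x\<close>. This factor is less than 1 exactly if
  \<open>x < 1 - 1 / sqrt 2\<close>, which is about 0.2929, while \<open>b > 1 / d\<close> forces \<open>x > 1 / sqrt d\<close>. The choice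
  \<open>x = 29 / 100\<close> satisfies both for all \<open>d \<ge> 14\<close> and leaves room for the factor \<open>101 / 100\<close>.

  Therefore almost surely only finitely many such paths are realised, so only finitely many particles
  ever visit the root. Each of them does so finitely often because a single walk is transient
  (\<open>AE_finite_returns\<close>).
\<close>

section \<open>Distance in the tree\<close>

text \<open>
  Recursion on the point x from which the distance is measured, rather than a formula with the common
  ancestor, since x is the vertex that moves: unless x is an ancestor of v, every geodesic to v
  begins at x with a step to the parent.
\<close>

primrec tree_dist :: "nat list \<Rightarrow> nat list \<Rightarrow> nat" where
  "tree_dist v [] = length v"
| "tree_dist v (k # x) =
    (if suffix (k # x) v then length v - length (k # x) else Suc (tree_dist v x))"

lemma tree_dist_suffix: "suffix x v \<Longrightarrow> tree_dist v x = length v - length x"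
  by (cases x) auto

lemma tree_dist_root: "tree_dist [] x = length x"
  by (induction x) auto

lemma tree_dist_self [simp]: "tree_dist v v = 0"
  by (simp add: tree_dist_suffix)

lemma sum_neighbour:
  fixes g :: "nat list \<Rightarrow> real"
  shows "(\<Sum>k\<in>{0..d}. g (neighbour d (a # y) k)) = g y + (\<Sum>k\<in>{0..<d}. g (k # a # y))"
proof -
  have "{0..d} = insert d {0..<d}" by auto
  then show ?thesis by simp
qed

lemma is_vertex_middle: "is_vertex d (xs @ k # y) \<Longrightarrow> if y = [] then k \<le> d else k < d"
proof (induction xs)
  case Nil
  then show ?case by (cases y) auto
next
  case (Cons a xs)
  then show ?case using is_vertex_ConsD by auto
qed

text \<open>
  Away from v exactly one neighbour of x is closer to v, and the d others are farther away; the
  weights \<open>d\<close> and \<open>d * (1 / d)\<close> add up to \<open>d + 1\<close>. Thus \<open>(1 / d) ^ tree_dist v x\<close> dominates the probability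
  that a walk from x hits v.
\<close>

lemma tree_dist_superharmonic:
  assumes "is_vertex d v" and "x \<noteq> v" and d: "d \<ge> 1"
  shows "(\<Sum>k\<in>{0..d}. (1 / real d) ^ tree_dist v (neighbour d x k))
    \<le> (real d + 1) * (1 / real d) ^ tree_dist v x"
proof (cases "suffix x v")
  case True
  then obtain zs where zs: "v = zs @ x" by (auto simp: suffix_def)
  with \<open>x \<noteq> v\<close> obtain ys j where v: "v = ys @ j # x"
    by (cases zs rule: rev_cases) auto
  define n where "n = length ys"
  have down: "(1 / real d) ^ tree_dist v (k # x) = (if k = j then (1 / real d) ^ n else (1 / real d) ^ (n + 2))" for k
  proof -
    have "suffix (k # x) v \<longleftrightarrow> k = j" using v by (auto simp: suffix_def)
    moreover have "tree_dist v x = n + 1" using tree_dist_suffix[OF True] v n_def by simp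
    ultimately show ?thesis using v n_def by auto
  qed
  have dx: "tree_dist v x = n + 1" using tree_dist_suffix[OF True] v n_def by simp
  have identity: "(1 / real d) ^ n + real d * (1 / real d) ^ (n + 2) = (real d + 1) * (1 / real d) ^ (n + 1)"
    using d by (simp add: field_simps)
  show ?thesis
  proof (cases x)
    case Nil
    have "j \<in> {0..d}" using is_vertex_middle[of d ys j x] assms(1) v Nil by auto
    then have "(\<Sum>k\<in>{0..d}. (1 / real d) ^ tree_dist v (neighbour d x k))
      = (1 / real d) ^ n + (\<Sum>k\<in>{0..d} - {j}. (1 / real d) ^ (n + 2))"
      using down Nil by (subst sum.remove[of _ j]) (auto intro!: sum.cong)
    also have "\<dots> = (1 / real d) ^ n + real d * (1 / real d) ^ (n + 2)"
      using \<open>j \<in> {0..d}\<close> by simp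
    finally show ?thesis using identity dx by simp
  next
    case (Cons a y)
    have "j \<in> {0..<d}" using is_vertex_middle[of d ys j x] assms(1) v Cons by auto
    have "suffix y v" using True suffix_ConsD[of a y v] Cons by simp
    then have up: "tree_dist v y = n + 2"
      using tree_dist_suffix v n_def Cons by auto
    have "(\<Sum>k\<in>{0..<d}. (1 / real d) ^ tree_dist v (k # x))
      = (1 / real d) ^ n + (\<Sum>k\<in>{0..<d} - {j}. (1 / real d) ^ (n + 2))"
      using down \<open>j \<in> {0..<d}\<close> by (subst sum.remove[of _ j]) (auto intro!: sum.cong)
    also have "\<dots> = (1 / real d) ^ n + real (d - 1) * (1 / real d) ^ (n + 2)"
      using \<open>j \<in> {0..<d}\<close> by simp
    also have "real (d - 1) = real d - 1" using d by simp
    finally have "(\<Sum>k\<in>{0..d}. (1 / real d) ^ tree_dist v (neighbour d x k))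
      = (1 / real d) ^ (n + 2) + ((1 / real d) ^ n + (real d - 1) * (1 / real d) ^ (n + 2))"
      unfolding Cons sum_neighbour[where g = "\<lambda>z. (1 / real d) ^ tree_dist v z"] up by simp
    also have "\<dots> = (1 / real d) ^ n + real d * (1 / real d) ^ (n + 2)"
    proof -
      have "A + (B + (e - 1) * A) = B + e * A" for A B e :: real by (simp add: algebra_simps)
      then show ?thesis .
    qed
    finally show ?thesis using identity dx by simp
  qed
next
  case False
  then obtain a y where x: "x = a # y" by (cases x) auto
  have "\<not> suffix (k # x) v" for k by (rule contrapos_nn[OF False]) (rule suffix_ConsD)
  then have "tree_dist v (k # x) = tree_dist v y + 2" for k using False x by simp
  then have "(\<Sum>k\<in>{0..d}. (1 / real d) ^ tree_dist v (neighbour d x k))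
      = (1 / real d) ^ tree_dist v y + real d * (1 / real d) ^ (tree_dist v y + 2)"
    unfolding x sum_neighbour[where g = "\<lambda>z. (1 / real d) ^ tree_dist v z"] by simp
  also have "\<dots> = (real d + 1) * (1 / real d) ^ (tree_dist v y + 1)"
    using d by (simp add: field_simps)
  finally show ?thesis using False x by simp
qed

section \<open>Counting walks by their words of steps\<close>

text \<open>
  A walk of n steps is determined by its word of neighbour indices, and all \<open>(d + 1) ^ n\<close> words are
  equally likely. Probabilities of events about n steps of one walk are therefore word counts, and
  the Markov property at the first step is the splitting of a word into head and tail.
\<close>

definition words :: "nat \<Rightarrow> nat \<Rightarrow> nat list set" where
  "words d n = {ks. length ks = n \<and> set ks \<subseteq> {0..d}}"

lemma finite_words [simp]: "finite (words d n)"
  unfolding words_def using finite_lists_length_eq[of "{0..d}" n] by (simp add: conj_commute)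

lemma sum_words_Suc:
  fixes f :: "nat list \<Rightarrow> real"
  shows "(\<Sum>ks\<in>words d (Suc n). f ks) = (\<Sum>k\<in>{0..d}. \<Sum>ks\<in>words d n. f (k # ks))"
proof -
  have "words d (Suc n) = (\<lambda>(k, ks). k # ks) ` ({0..d} \<times> words d n)"
    by (auto simp: words_def length_Suc_conv image_iff)
  moreover have "inj_on (\<lambda>(k, ks). k # ks) ({0..d} \<times> words d n)"
    by (auto simp: inj_on_def)
  ultimately show ?thesis
    by (simp add: sum.reindex sum.cartesian_product case_prod_unfold)
qed

primrec visits :: "nat \<Rightarrow> nat list \<Rightarrow> nat list \<Rightarrow> nat list \<Rightarrow> bool" where
  "visits d v x [] \<longleftrightarrow> x = v"
| "visits d v x (k # ks) \<longleftrightarrow> x = v \<or> visits d v (neighbour d x k) ks"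

lemma card_words: "card (words d n) = (d + 1) ^ n"
  unfolding words_def using card_lists_length_eq[of "{0..d}" n] by (simp add: conj_commute)

lemma count_visits:
  assumes v: "is_vertex d v" and d: "d \<ge> 1"
  shows "(\<Sum>ks\<in>words d n. of_bool (visits d v x ks))
    \<le> (real d + 1) ^ n * (1 / real d) ^ tree_dist v x"
proof (induction n arbitrary: x)
  case 0
  have "words d 0 = {[]}" by (auto simp: words_def)
  then show ?case by auto
next
  case (Suc n)
  show ?case
  proof (cases "x = v")
    case True
    have "(\<Sum>ks\<in>words d (Suc n). of_bool (visits d v x ks)) \<le> (\<Sum>ks\<in>words d (Suc n). 1 :: real)"
      by (intro sum_mono) auto
    also have "\<dots> = (real d + 1) ^ Suc n" by (simp add: card_words algebra_simps)
    finally show ?thesis using True by simp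
  next
    case False
    have "(\<Sum>ks\<in>words d (Suc n). of_bool (visits d v x ks))
      = (\<Sum>k\<in>{0..d}. \<Sum>ks\<in>words d n. of_bool (visits d v (neighbour d x k) ks) :: real)"
      using False by (simp add: sum_words_Suc)
    also have "\<dots> \<le> (\<Sum>k\<in>{0..d}. (real d + 1) ^ n * (1 / real d) ^ tree_dist v (neighbour d x k))"
      by (intro sum_mono Suc)
    also have "\<dots> \<le> (real d + 1) ^ n * ((real d + 1) * (1 / real d) ^ tree_dist v x)"
      unfolding sum_distrib_left[symmetric]
      by (intro mult_left_mono tree_dist_superharmonic[OF v False d]) auto
    finally show ?thesis by (simp add: mult_ac)
  qed
qed

text \<open>
  The function \<open>(1 / sqrt d) ^ length x\<close> is an eigenfunction away from the root for the spectral radius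
  \<open>2 * sqrt d / (d + 1)\<close> of the walk. It dominates the indicator of the root, so return probabilities
  decay geometrically. At the root itself only \<open>d + 1 \<le> 2 * d\<close> is used.
\<close>

lemma count_returns:
  assumes d: "d \<ge> 1"
  shows "(\<Sum>ks\<in>words d n. of_bool (foldl (neighbour d) x ks = []))
    \<le> (2 * sqrt d) ^ n * (1 / sqrt d) ^ length x"
proof (induction n arbitrary: x)
  case 0
  have "words d 0 = {[]}" by (auto simp: words_def)
  then show ?case using d by (cases "x = []") auto
next
  case (Suc n)
  define q where "q = sqrt (real d)"
  let ?r = "1 / q"
  have q: "q \<ge> 1" and dq: "real d = q * q" using d by (auto simp: q_def)
  have step: "(\<Sum>k\<in>{0..d}. ?r ^ length (neighbour d x k)) \<le> 2 * q * ?r ^ length x"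
  proof (cases x)
    case Nil
    have "1 \<le> q * q" using q mult_mono[of 1 q 1 q] by simp
    then have "q * q + 1 \<le> 2 * q * q" by simp
    then have "(q * q + 1) / q \<le> 2 * q" using q by (subst pos_divide_le_eq) auto
    then show ?thesis using Nil dq by (simp add: add.commute)
  next
    case (Cons a y)
    have "?r ^ m + (q * q) * ?r ^ (m + 2) = 2 * q * ?r ^ (m + 1)" for m
      using q by (simp add: field_simps)
    from this[of "length y"] show ?thesis
      unfolding Cons sum_neighbour[where g = "\<lambda>z. ?r ^ length z"] using dq by simp
  qed
  have "(\<Sum>ks\<in>words d (Suc n). of_bool (foldl (neighbour d) x ks = []))
      = (\<Sum>k\<in>{0..d}. \<Sum>ks\<in>words d n. of_bool (foldl (neighbour d) (neighbour d x k) ks = []) :: real)"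
    by (simp add: sum_words_Suc)
  also have "\<dots> \<le> (\<Sum>k\<in>{0..d}. (2 * q) ^ n * ?r ^ length (neighbour d x k))"
    by (intro sum_mono Suc[folded q_def])
  also have "\<dots> \<le> (2 * q) ^ n * (2 * q * ?r ^ length x)"
    unfolding sum_distrib_left[symmetric] by (intro mult_left_mono step) (use q in auto)
  finally show ?case by (simp add: q_def mult_ac)
qed

section \<open>Summing weights over paths\<close>

lemma nn_integral_lists:
  fixes f :: "'a list \<Rightarrow> ennreal"
  shows "(\<integral>\<^sup>+ xs. f xs \<partial>count_space UNIV)
    = f [] + (\<integral>\<^sup>+ x. (\<integral>\<^sup>+ xs. f (x # xs) \<partial>count_space UNIV) \<partial>count_space UNIV)"
proof -
  let ?R = "range (\<lambda>(x, xs). x # xs :: 'a list)"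
  have U: "UNIV = {[] :: 'a list} \<union> ?R"
    by (auto simp: image_iff) (metis list.exhaust)
  have "(\<integral>\<^sup>+ xs. f xs \<partial>count_space UNIV)
    = (\<integral>\<^sup>+ xs. f xs * indicator {[]} xs + f xs * indicator ?R xs \<partial>count_space UNIV)"
    using U by (intro nn_integral_cong) (auto split: split_indicator)
  also have "\<dots> = (\<integral>\<^sup>+ xs. f xs * indicator {[]} xs \<partial>count_space UNIV)
     + (\<integral>\<^sup>+ xs. f xs * indicator ?R xs \<partial>count_space UNIV)"
    by (intro nn_integral_add) auto
  also have "(\<integral>\<^sup>+ xs. f xs * indicator {[]} xs \<partial>count_space UNIV) = f []"
    by (subst nn_integral_count_space_indicator[symmetric]) (auto simp: nn_integral_count_space_finite)
  also have "(\<integral>\<^sup>+ xs. f xs * indicator ?R xs \<partial>count_space UNIV) = (\<integral>\<^sup>+ xs. f xs \<partial>count_space ?R)"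
    by (subst nn_integral_count_space_indicator[symmetric]) auto
  also have "\<dots> = (\<integral>\<^sup>+ p. f (fst p # snd p) \<partial>count_space UNIV)"
    by (subst nn_integral_bij_count_space[where g = "\<lambda>(x, xs). x # xs" and A = UNIV, symmetric])
       (auto simp: bij_betw_def inj_on_def case_prod_unfold)
  also have "\<dots> = (\<integral>\<^sup>+ x. (\<integral>\<^sup>+ xs. f (x # xs) \<partial>count_space UNIV) \<partial>count_space UNIV)"
    using nn_integral_fst_count_space[of "\<lambda>p. f (fst p # snd p)"] by simp
  finally show ?thesis .
qed

text \<open>
  The total weight of all paths from u is a geometric series: if one step multiplies the weight
  function h by at most l on average, then the sum is at most \<open>C * h u\<close> for every C with
  \<open>a + l * C \<le> C\<close>. Stating it with a supersolution C instead of \<open>a / (1 - l)\<close> avoids division in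
  \<^typ>\<open>ennreal\<close> and fits an induction on the length of the paths.
\<close>

lemma path_sum_le:
  fixes W :: "'a \<Rightarrow> 'a list \<Rightarrow> ennreal"
  assumes nil: "\<And>u. W u [] \<le> a * h u"
    and cons: "\<And>u x xs. W u (x # xs) \<le> w u x * W x xs"
    and contr: "\<And>u. (\<integral>\<^sup>+ x. w u x * h x \<partial>count_space UNIV) \<le> l * h u"
    and C: "a + l * C \<le> C"
  shows "(\<integral>\<^sup>+ xs. W u xs \<partial>count_space UNIV) \<le> C * h u"
proof -
  define F where "F m u xs = W u xs * indicator {..<m} (length xs)" for m u and xs :: "'a list"
  have bound: "(\<integral>\<^sup>+ xs. F m u xs \<partial>count_space UNIV) \<le> C * h u" for m u
  proof (induction m arbitrary: u)
    case 0
    then show ?case by (simp add: F_def)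
  next
    case (Suc m)
    have "(\<integral>\<^sup>+ xs. F (Suc m) u xs \<partial>count_space UNIV)
      = F (Suc m) u [] + (\<integral>\<^sup>+ x. (\<integral>\<^sup>+ xs. F (Suc m) u (x # xs) \<partial>count_space UNIV) \<partial>count_space UNIV)"
      by (rule nn_integral_lists)
    also have "\<dots> \<le> a * h u + (\<integral>\<^sup>+ x. w u x * (C * h x) \<partial>count_space UNIV)"
    proof (intro add_mono nn_integral_mono)
      show "F (Suc m) u [] \<le> a * h u" using nil by (simp add: F_def)
      fix x
      have "(\<integral>\<^sup>+ xs. F (Suc m) u (x # xs) \<partial>count_space UNIV)
        \<le> (\<integral>\<^sup>+ xs. w u x * F m x xs \<partial>count_space UNIV)"
        using cons by (intro nn_integral_mono) (auto simp: F_def split: split_indicator)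
      also have "\<dots> = w u x * (\<integral>\<^sup>+ xs. F m x xs \<partial>count_space UNIV)"
        by (rule nn_integral_cmult) auto
      also have "\<dots> \<le> w u x * (C * h x)" by (intro mult_left_mono Suc) auto
      finally show "(\<integral>\<^sup>+ xs. F (Suc m) u (x # xs) \<partial>count_space UNIV) \<le> w u x * (C * h x)" .
    qed
    also have "(\<integral>\<^sup>+ x. w u x * (C * h x) \<partial>count_space UNIV)
      = C * (\<integral>\<^sup>+ x. w u x * h x \<partial>count_space UNIV)"
      by (subst nn_integral_cmult[symmetric]) (auto simp: mult_ac)
    also have "a * h u + C * (\<integral>\<^sup>+ x. w u x * h x \<partial>count_space UNIV) \<le> a * h u + C * (l * h u)"
      by (intro add_left_mono mult_left_mono contr) auto
    also have "\<dots> = (a + l * C) * h u" by (simp add: algebra_simps)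
    also have "\<dots> \<le> C * h u" by (intro mult_right_mono C) auto
    finally show ?case .
  qed
  have "(\<integral>\<^sup>+ xs. W u xs \<partial>count_space UNIV) = (\<integral>\<^sup>+ xs. (SUP m. F m u xs) \<partial>count_space UNIV)"
  proof (intro nn_integral_cong antisym)
    fix xs
    have "W u xs = F (Suc (length xs)) u xs" by (simp add: F_def)
    also have "\<dots> \<le> (SUP m. F m u xs)" by (rule SUP_upper) simp
    finally show "W u xs \<le> (SUP m. F m u xs)" .
    show "(SUP m. F m u xs) \<le> W u xs"
      by (rule SUP_least) (auto simp: F_def split: split_indicator)
  qed
  also have "\<dots> = (SUP m. \<integral>\<^sup>+ xs. F m u xs \<partial>count_space UNIV)"
    by (rule nn_integral_monotone_convergence_SUP)
       (auto simp: incseq_def le_fun_def F_def split: split_indicator)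
  also have "\<dots> \<le> C * h u" by (rule SUP_least) (rule bound)
  finally show ?thesis .
qed

lemma list_weight_sum_le:
  fixes z C :: real
  assumes S: "finite S" and nn: "z \<ge> 0" "C \<ge> 0" and C: "1 + z * real (card S) * C \<le> C"
  shows "(\<integral>\<^sup>+ xs. ennreal z ^ length xs * indicator {xs. set xs \<subseteq> S} xs \<partial>count_space UNIV) \<le> ennreal C"
proof -
  have contr: "(\<integral>\<^sup>+ x. ennreal z * indicator S x * 1 \<partial>count_space UNIV)
      \<le> ennreal z * of_nat (card S) * 1"
    using S by (subst nn_integral_cmult_indicator mult_1_right)+ auto
  have "1 + ennreal z * of_nat (card S) * ennreal C = ennreal (1 + z * real (card S) * C)"
    using nn by (simp add: ennreal_mult ennreal_of_nat_eq_real_of_nat)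
  also have "\<dots> \<le> ennreal C" by (rule ennreal_leI) (rule C)
  finally have "1 + ennreal z * of_nat (card S) * ennreal C \<le> ennreal C" .
  from path_sum_le[where W = "\<lambda>_ xs. ennreal z ^ length xs * indicator {xs. set xs \<subseteq> S} xs"
      and h = "\<lambda>_. 1" and a = 1, OF _ _ contr this]
  show ?thesis by (auto split: split_indicator)
qed

definition level_weight :: "nat \<Rightarrow> real" where
  "level_weight d = 1 / sqrt (real d)"

text \<open>
  The decay rate b of the hop probabilities, chosen such that \<open>b * sqrt d = 29 / 100\<close>, just below the
  critical value \<open>1 - 1 / sqrt 2\<close>.
\<close>

definition hop_base :: "nat \<Rightarrow> real" where
  "hop_base d = 29 / 100 / sqrt (real d)"

text \<open>
  Every v either lies below u or has its geodesic from \<open>u = k # u'\<close> pass through u', so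
  the sum S over all v satisfies \<open>S u \<le> r ^ length u / (1 - x) + b * S u'\<close> with \<open>x = 29 / 100\<close>. As
  \<open>b = x * r\<close>, the fixed point of this recursion is \<open>r ^ length u / (1 - x)\<^sup>2\<close>, and
  \<open>1 / (1 - x)\<^sup>2 = 10000 / 5041\<close>. At the root there are \<open>d + 1\<close> children to start with, but the resulting sum
  is still well below the fixed point.
\<close>

lemma hop_weight_sum_le:
  assumes d: "d \<ge> 14"
  shows "(\<integral>\<^sup>+ v. ennreal (hop_base d ^ tree_dist v u * level_weight d ^ length v) * indicator (vertices d) v
      \<partial>count_space UNIV) \<le> ennreal (10000 / 5041) * ennreal (level_weight d ^ length u)"
proof (induction u)
  case Nil
  define z where "z = 29 / 100 / real d"
  have z: "hop_base d * level_weight d = z" "z \<ge> 0"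
    by (auto simp: hop_base_def level_weight_def z_def)
  \<comment> \<open>All letters up to d are allowed at every position, which only overcounts the vertices.\<close>
  have "z * (real d + 1) \<le> 29 / 100 * (15 / 14)" using d by (simp add: z_def field_simps)
  then have "1 + z * (real d + 1) * (10000 / 5041) \<le> 10000 / 5041" by simp
  moreover have "(\<integral>\<^sup>+ xs. ennreal z ^ length xs * indicator {xs. set xs \<subseteq> {0..d}} xs \<partial>count_space UNIV)
    \<le> ennreal (10000 / 5041)"
    using z calculation by (intro list_weight_sum_le) (auto simp: add.commute)
  moreover have "(\<integral>\<^sup>+ v. ennreal (hop_base d ^ tree_dist v [] * level_weight d ^ length v) * indicator (vertices d) v
      \<partial>count_space UNIV) \<le> (\<integral>\<^sup>+ xs. ennreal z ^ length xs * indicator {xs. set xs \<subseteq> {0..d}} xs \<partial>count_space UNIV)"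
  proof (intro nn_integral_mono mult_mono)
    fix v
    show "ennreal (hop_base d ^ tree_dist v [] * level_weight d ^ length v) \<le> ennreal z ^ length v"
      using z by (simp add: power_mult_distrib[symmetric] ennreal_power)
    have "is_vertex d v \<Longrightarrow> set v \<subseteq> {0..d}"
      by (induction v rule: is_vertex.induct) auto
    then show "indicator (vertices d) v \<le> (indicator {xs. set xs \<subseteq> {0..d}} v :: ennreal)"
      by (auto simp: vertices_def split: split_indicator)
  qed auto
  ultimately show ?case by (auto intro: order_trans)
next
  case (Cons k u)
  let ?b = "hop_base d" and ?r = "level_weight d" and ?u = "k # u"
  define z where "z = 29 / 100 / real d"
  have z: "?b * ?r = z" "z \<ge> 0" and zd: "z * real d = 29 / 100"
    using d by (auto simp: hop_base_def level_weight_def z_def)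
  have nn: "?b \<ge> 0" "?r \<ge> 0" by (auto simp: hop_base_def level_weight_def)
  have br: "?b = 29 / 100 * ?r" by (simp add: hop_base_def level_weight_def)
  define D where "D = {v. is_vertex d v \<and> suffix ?u v}"
  let ?f = "\<lambda>u v. ennreal (?b ^ tree_dist v u * ?r ^ length v)"
  have "(\<integral>\<^sup>+ v. ?f ?u v * indicator (vertices d) v \<partial>count_space UNIV)
    \<le> (\<integral>\<^sup>+ v. ?f ?u v * indicator D v + ennreal ?b * (?f u v * indicator (vertices d) v) \<partial>count_space UNIV)"
  proof (intro nn_integral_mono)
    fix v
    show "?f ?u v * indicator (vertices d) v \<le> ?f ?u v * indicator D v + ennreal ?b * (?f u v * indicator (vertices d) v)"
    proof (cases "suffix ?u v")
      case True
      then show ?thesis by (auto simp: D_def vertices_def split: split_indicator)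
    next
      case False
      then have "?f ?u v = ennreal ?b * ?f u v"
        using nn by (simp add: ennreal_mult[symmetric] mult.assoc)
      then show ?thesis by (auto simp: mult.assoc)
    qed
  qed
  also have "\<dots> = (\<integral>\<^sup>+ v. ?f ?u v * indicator D v \<partial>count_space UNIV)
      + (\<integral>\<^sup>+ v. ennreal ?b * (?f u v * indicator (vertices d) v) \<partial>count_space UNIV)"
    by (rule nn_integral_add) auto
  also have "(\<integral>\<^sup>+ v. ennreal ?b * (?f u v * indicator (vertices d) v) \<partial>count_space UNIV)
      = ennreal ?b * (\<integral>\<^sup>+ v. ?f u v * indicator (vertices d) v \<partial>count_space UNIV)"
    by (rule nn_integral_cmult) auto
  also have "(\<integral>\<^sup>+ v. ?f ?u v * indicator D v \<partial>count_space UNIV)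
    \<le> ennreal (?r ^ length ?u) * ennreal (100 / 71)"
  proof -
    define Y where "Y = {ys. is_vertex d (ys @ ?u)}"
    have "bij_betw (\<lambda>ys. ys @ ?u) Y D"
      by (auto simp: bij_betw_def inj_on_def D_def Y_def suffix_def)
    then have "(\<integral>\<^sup>+ v. ?f ?u v * indicator D v \<partial>count_space UNIV)
      = (\<integral>\<^sup>+ ys. ?f ?u (ys @ ?u) * indicator Y ys \<partial>count_space UNIV)"
      by (simp add: nn_integral_count_space_indicator[symmetric] nn_integral_bij_count_space[symmetric])
    also have "\<dots> \<le> (\<integral>\<^sup>+ ys. ennreal (?r ^ length ?u) * (ennreal z ^ length ys * indicator {ys. set ys \<subseteq> {0..<d}} ys) \<partial>count_space UNIV)"
    proof (intro nn_integral_mono)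
      fix ys
      have "tree_dist (ys @ ?u) ?u = length ys" by (subst tree_dist_suffix) (auto simp: suffix_def)
      then have "?f ?u (ys @ ?u) = ennreal (?r ^ length ?u) * ennreal z ^ length ys"
        using nn z by (simp add: power_mult_distrib[symmetric] ennreal_power ennreal_mult[symmetric]
            power_add mult_ac flip: z(1))
      moreover have "set ys \<subseteq> {0..<d}" if "ys \<in> Y"
        using that unfolding Y_def
        by (auto dest!: split_list is_vertex_middle[of d _ _ "_ @ ?u", simplified])
      ultimately show "?f ?u (ys @ ?u) * indicator Y ys
        \<le> ennreal (?r ^ length ?u) * (ennreal z ^ length ys * indicator {ys. set ys \<subseteq> {0..<d}} ys)"
        by (auto simp: mult.assoc split: split_indicator)
    qed
    also have "\<dots> = ennreal (?r ^ length ?u) * (\<integral>\<^sup>+ ys. ennreal z ^ length ys * indicator {ys. set ys \<subseteq> {0..<d}} ys \<partial>count_space UNIV)"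
      by (rule nn_integral_cmult) auto
    also have "\<dots> \<le> ennreal (?r ^ length ?u) * ennreal (100 / 71)"
      using z zd by (intro mult_left_mono list_weight_sum_le) auto
    finally show ?thesis .
  qed
  also have "ennreal ?b * (\<integral>\<^sup>+ v. ?f u v * indicator (vertices d) v \<partial>count_space UNIV)
    \<le> ennreal ?b * (ennreal (10000 / 5041) * ennreal (?r ^ length u))"
    by (intro mult_left_mono Cons) auto
  also have "ennreal (?r ^ length ?u) * ennreal (100 / 71) + ennreal ?b * (ennreal (10000 / 5041) * ennreal (?r ^ length u))
    = ennreal (?r ^ length ?u * (100 / 71) + ?b * (10000 / 5041 * ?r ^ length u))"
    using nn by (simp add: ennreal_mult[symmetric] ennreal_plus[symmetric] del: ennreal_plus)
  also have "?r ^ length ?u * (100 / 71) + ?b * (10000 / 5041 * ?r ^ length u) = 10000 / 5041 * ?r ^ length ?u"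
    by (simp add: br)
  finally have le: "(\<integral>\<^sup>+ v. ?f ?u v * indicator (vertices d) v \<partial>count_space UNIV)
      \<le> ennreal (10000 / 5041 * ?r ^ length ?u)"
    by (simp only: add_mono order_refl)
  have e: "ennreal (10000 / 5041 * ?r ^ length ?u) = ennreal (10000 / 5041) * ennreal (?r ^ length ?u)"
    by (rule ennreal_mult) (use nn in auto)
  show ?case using le unfolding e .
qed

section \<open>Hitting probabilities\<close>

definition step_space :: "nat \<Rightarrow> (particle \<times> nat \<Rightarrow> nat) measure" where
  "step_space d = (\<Pi>\<^sub>M j\<in>(vertices d \<times> UNIV) \<times> UNIV. measure_pmf (pmf_of_set {0..d}))"

lemma prob_space_step_space: "prob_space (step_space d)"
  unfolding step_space_def by (intro prob_space_PiM) (rule prob_space_measure_pmf)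

lemma indep_vars_coordinates:
  fixes I :: "'i set" and M :: "'i \<Rightarrow> 'a measure"
  assumes M: "\<And>i. i \<in> I \<Longrightarrow> prob_space (M i)"
  shows "prob_space.indep_vars (PiM I M) M (\<lambda>i \<omega>. \<omega> i) I"
proof -
  interpret P: prob_space "PiM I M" by (rule prob_space_PiM) (rule M)
  show ?thesis
  proof (cases "I = {}")
    case True
    then show ?thesis unfolding P.indep_vars_def P.indep_sets_def by auto
  next
    case False
    have "distr (PiM I M) (PiM I M) (\<lambda>x. \<lambda>i\<in>I. x i) = distr (PiM I M) (PiM I M) (\<lambda>x. x)"
      by (rule distr_cong) (auto simp: space_PiM PiE_def extensional_restrict)
    also have "\<dots> = PiM I M" by (rule distr_id)
    also have "\<dots> = (\<Pi>\<^sub>M i\<in>I. distr (PiM I M) (M i) (\<lambda>x. x i))"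
      by (rule PiM_cong) (auto simp: distr_PiM_component M)
    finally show ?thesis
      by (subst P.indep_vars_iff_distr_eq_PiM'[OF False]) auto
  qed
qed

lemma walk_eq_foldl:
  "walk d U p n = foldl (neighbour d) (fst p) (map (\<lambda>k. U (p, k)) [0..<n])"
  by (induction n) auto

lemma visits_iff:
  "visits d v x (map f [0..<n]) \<longleftrightarrow> (\<exists>m\<le>n. foldl (neighbour d) x (map f [0..<m]) = v)"
proof (induction n arbitrary: x f)
  case 0
  then show ?case by simp
next
  case (Suc n)
  have e: "map f [0..<Suc m] = f 0 # map (\<lambda>k. f (Suc k)) [0..<m]" for m
    by (simp only: map_upt_Suc)
  have "visits d v x (map f [0..<Suc n])
    \<longleftrightarrow> x = v \<or> (\<exists>m\<le>n. foldl (neighbour d) x (map f [0..<Suc m]) = v)"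
    unfolding e by (simp add: Suc del: upt_Suc)
  also have "\<dots> \<longleftrightarrow> (\<exists>m\<le>Suc n. foldl (neighbour d) x (map f [0..<m]) = v)"
    by (auto simp: ex_simps(1)[symmetric] simp del: upt_Suc dest: Suc_le_D) 
      (metis Suc_le_mono not0_implies_Suc foldl_Nil list.map(1) upt_0 bot_nat_0.extremum)+
  finally show ?case .
qed

lemma measurable_walk:
  assumes "\<And>k. (p, k) \<in> K"
  shows "(\<lambda>U. walk d U p n) \<in> measurable (PiM K (\<lambda>_. measure_pmf (pmf_of_set {0..d}))) (count_space UNIV)"
proof (induction n)
  case 0
  then show ?case by simp
next
  case (Suc n)
  have "(\<lambda>U. U (p, n)) \<in> measurable (PiM K (\<lambda>_. measure_pmf (pmf_of_set {0..d}))) (count_space UNIV)"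
    using measurable_component_singleton[OF assms, of n "\<lambda>_. measure_pmf (pmf_of_set {0..d})"] by simp
  then show ?case
    using Suc by (simp add: measurable_compose_countable[where g = "\<lambda>U. walk d U p n" and f = "\<lambda>x U. neighbour d x (U (p, n))"])
qed

lemma measurable_walk_step_space [measurable]:
  assumes "p \<in> vertices d \<times> UNIV"
  shows "(\<lambda>U. walk d U p n) \<in> measurable (step_space d) (count_space UNIV)"
  unfolding step_space_def by (rule measurable_walk) (use assms in auto)

lemma AE_steps_le: "AE U in step_space d. \<forall>j\<in>(vertices d \<times> UNIV) \<times> UNIV. U j \<le> d"
proof (subst AE_ball_countable)
  show "\<forall>j\<in>(vertices d \<times> UNIV) \<times> UNIV. AE U in step_space d. U j \<le> d"
    unfolding step_space_def
    by (intro ballI AE_PiM_component) (auto simp: prob_space_measure_pmf AE_measure_pmf_iff)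
qed auto

lemma emeasure_walk_word:
  assumes p: "p \<in> vertices d \<times> UNIV"
    and meas: "{U \<in> space (step_space d). Q (map (\<lambda>k. U (p, k)) [0..<n])} \<in> sets (step_space d)"
  shows "emeasure (step_space d) {U \<in> space (step_space d). Q (map (\<lambda>k. U (p, k)) [0..<n])}
    \<le> ennreal ((\<Sum>ks\<in>words d n. of_bool (Q ks)) / (real d + 1) ^ n)"
proof -
  let ?I = "(vertices d \<times> UNIV) \<times> UNIV :: (particle \<times> nat) set"
  let ?M = "\<lambda>_ :: particle \<times> nat. measure_pmf (pmf_of_set {0..d})"
  interpret prob_space "step_space d" by (rule prob_space_step_space)
  define cyl where "cyl ks = prod_emb ?I ?M ((\<lambda>k. (p, k)) ` {..<n})
      (PiE ((\<lambda>k. (p, k)) ` {..<n}) (\<lambda>j. {ks ! snd j}))" for ks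
  have cyl: "emeasure (step_space d) (cyl ks) = ennreal ((1 / (real d + 1)) ^ n)"
    if "ks \<in> words d n" for ks
  proof -
    have "emeasure (step_space d) (cyl ks)
      = (\<Prod>j\<in>(\<lambda>k. (p, k)) ` {..<n}. emeasure (pmf_of_set {0..d}) {ks ! snd j})"
      unfolding step_space_def cyl_def
      by (rule emeasure_PiM_emb) (use p in \<open>auto simp: prob_space_measure_pmf\<close>)
    also have "\<dots> = (\<Prod>k<n. emeasure (pmf_of_set {0..d}) {ks ! k})"
      by (subst prod.reindex) (auto simp: inj_on_def)
    also have "\<dots> = (\<Prod>k<n. ennreal (1 / (real d + 1)))"
    proof (intro prod.cong refl)
      fix k assume "k \<in> {..<n}"
      then have "ks ! k \<in> set ks" "set ks \<subseteq> {0..d}" using that by (auto simp: words_def)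
      then have "ks ! k \<in> {0..d}" by blast
      then show "emeasure (pmf_of_set {0..d}) {ks ! k} = ennreal (1 / (real d + 1))"
        by (simp add: emeasure_pmf_single pmf_of_set add.commute)
    qed
    also have "\<dots> = ennreal ((1 / (real d + 1)) ^ n)" by (simp add: ennreal_power)
    finally show ?thesis .
  qed
  have cyl_sets: "cyl ks \<in> sets (step_space d)" for ks
    unfolding step_space_def cyl_def by (rule sets_PiM_I) (use p in auto)
  let ?W = "{ks \<in> words d n. Q ks}"
  have "emeasure (step_space d) {U \<in> space (step_space d). Q (map (\<lambda>k. U (p, k)) [0..<n])}
    \<le> emeasure (step_space d) (\<Union>ks\<in>?W. cyl ks)"
  proof (rule emeasure_mono_AE)
    show "AE U in step_space d. U \<in> {U \<in> space (step_space d). Q (map (\<lambda>k. U (p, k)) [0..<n])}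
        \<longrightarrow> U \<in> (\<Union>ks\<in>?W. cyl ks)"
      using AE_steps_le
    proof (eventually_elim, intro impI)
      fix U assume U: "\<forall>j\<in>?I. U j \<le> d"
        and "U \<in> {U \<in> space (step_space d). Q (map (\<lambda>k. U (p, k)) [0..<n])}"
      then have Q: "U \<in> space (step_space d)" "Q (map (\<lambda>k. U (p, k)) [0..<n])" by auto
      have "map (\<lambda>k. U (p, k)) [0..<n] \<in> ?W"
        using Q U p by (auto simp: words_def)
      moreover have "U \<in> cyl (map (\<lambda>k. U (p, k)) [0..<n])"
        using Q(1) unfolding cyl_def step_space_def by (auto simp: prod_emb_def space_PiM)
      ultimately show "U \<in> (\<Union>ks\<in>?W. cyl ks)" by blast
    qed
    show "(\<Union>ks\<in>?W. cyl ks) \<in> sets (step_space d)"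
      using cyl_sets by (intro sets.finite_UN) auto
  qed
  also have "\<dots> \<le> (\<Sum>ks\<in>?W. emeasure (step_space d) (cyl ks))"
    using cyl_sets by (intro emeasure_subadditive_finite) auto
  also have "\<dots> = (\<Sum>ks\<in>?W. ennreal ((1 / (real d + 1)) ^ n))"
    by (intro sum.cong) (auto simp: cyl)
  also have "\<dots> = ennreal (\<Sum>ks\<in>?W. (1 / (real d + 1)) ^ n)" by (intro sum_ennreal) auto
  also have "(\<Sum>ks\<in>?W. (1 / (real d + 1)) ^ n) = (\<Sum>ks\<in>words d n. of_bool (Q ks)) / (real d + 1) ^ n"
    by (simp add: Int_def power_one_over field_simps)
  finally show ?thesis .
qed

text \<open>
  The bound on the number of words does not depend on n, so it survives the passage from hitting
  within n steps to hitting at all.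
\<close>

lemma prob_particle_hits:
  assumes p: "p \<in> vertices d \<times> UNIV" and v: "is_vertex d v" and d: "d \<ge> 1"
  shows "emeasure (step_space d) {U \<in> space (step_space d). \<exists>n. walk d U p n = v}
    \<le> ennreal ((1 / real d) ^ tree_dist v (fst p))"
proof -
  note measurable_walk_step_space[OF p, measurable]
  define A where "A n = {U \<in> space (step_space d). \<exists>m\<le>n. walk d U p m = v}" for n
  have [measurable]: "A n \<in> sets (step_space d)" for n
    unfolding A_def by measurable
  have A: "A n = {U \<in> space (step_space d). visits d v (fst p) (map (\<lambda>k. U (p, k)) [0..<n])}" for n
    unfolding A_def visits_iff walk_eq_foldl ..
  have "{U \<in> space (step_space d). \<exists>n. walk d U p n = v} = (\<Union>n. A n)"
    by (auto simp: A_def)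
  then have "emeasure (step_space d) {U \<in> space (step_space d). \<exists>n. walk d U p n = v}
    = (SUP n. emeasure (step_space d) (A n))"
    by (simp, subst SUP_emeasure_incseq[symmetric])
       (auto simp: incseq_def A_def intro: order_trans)
  also have "\<dots> \<le> ennreal ((1 / real d) ^ tree_dist v (fst p))"
  proof (rule SUP_least)
    fix n
    have "emeasure (step_space d) (A n)
      \<le> ennreal ((\<Sum>ks\<in>words d n. of_bool (visits d v (fst p) ks)) / (real d + 1) ^ n)"
      unfolding A by (rule emeasure_walk_word[OF p]) (simp flip: A)
    also have "\<dots> \<le> ennreal ((1 / real d) ^ tree_dist v (fst p))"
      using count_visits[OF v d, where n = n and x = "fst p"]
      by (intro ennreal_leI) (simp add: divide_le_eq mult.commute)
    finally show "emeasure (step_space d) (A n) \<le> ennreal ((1 / real d) ^ tree_dist v (fst p))" .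
  qed
  finally show ?thesis .
qed

text \<open>
  Transience of a single walk: \<open>2 * sqrt d < d + 1\<close>, so the return probabilities are summable and the
  Borel-Cantelli lemma applies.
\<close>

lemma AE_finite_returns:
  assumes p: "p \<in> vertices d \<times> UNIV" and d: "d \<ge> 2"
  shows "AE U in step_space d. finite {n. walk d U p n = []}"
proof -
  note measurable_walk_step_space[OF p, measurable]
  interpret prob_space "step_space d" by (rule prob_space_step_space)
  define A where "A n = {U \<in> space (step_space d). walk d U p n = []}" for n
  have [measurable]: "A n \<in> sets (step_space d)" for n
    unfolding A_def by measurable
  define q where "q = 2 * sqrt (real d) / (real d + 1)"
  have "0 < (sqrt (real d) - 1)\<^sup>2" using d by simp
  then have "2 * sqrt (real d) < real d + 1" by (simp add: power2_diff)
  then have q: "0 \<le> q" "q < 1" by (auto simp: q_def)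
  have "AE U in step_space d. eventually (\<lambda>n. U \<in> space (step_space d) - A n) sequentially"
  proof (rule borel_cantelli_AE1)
    show "summable (\<lambda>n. prob (A n))"
    proof (rule summable_comparison_test')
      show "summable (\<lambda>n. q ^ n * (1 / sqrt d) ^ length (fst p))"
        using q by (intro summable_mult2 summable_geometric) auto
      fix n :: nat
      have A: "A n = {U \<in> space (step_space d). foldl (neighbour d) (fst p) (map (\<lambda>k. U (p, k)) [0..<n]) = []}"
        unfolding A_def walk_eq_foldl ..
      have "ennreal (prob (A n))
        \<le> ennreal ((\<Sum>ks\<in>words d n. of_bool (foldl (neighbour d) (fst p) ks = [])) / (real d + 1) ^ n)"
        unfolding A emeasure_eq_measure[symmetric]
        by (rule emeasure_walk_word[OF p, where Q = "\<lambda>ks. foldl (neighbour d) (fst p) ks = []"]) (simp flip: A)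
      also have "\<dots> \<le> ennreal ((2 * sqrt d) ^ n * (1 / sqrt d) ^ length (fst p) / (real d + 1) ^ n)"
        using d by (intro ennreal_leI divide_right_mono count_returns) auto
      also have "(2 * sqrt d) ^ n * (1 / sqrt d) ^ length (fst p) / (real d + 1) ^ n
          = q ^ n * (1 / sqrt d) ^ length (fst p)"
        by (simp add: q_def power_divide)
      finally have "prob (A n) \<le> q ^ n * (1 / sqrt d) ^ length (fst p)"
        using q by (subst (asm) ennreal_le_iff) auto
      then show "norm (prob (A n)) \<le> q ^ n * (1 / sqrt d) ^ length (fst p)" by simp
    qed
  qed (auto simp: emeasure_eq_measure)
  then show ?thesis
  proof (eventually_elim)
    fix U assume "eventually (\<lambda>n. U \<in> space (step_space d) - A n) sequentially"
    then obtain N where "\<And>n. n \<ge> N \<Longrightarrow> U \<in> space (step_space d) - A n"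
      by (auto simp: eventually_sequentially)
    then have "{n. walk d U p n = []} \<subseteq> {..<N}"
      by (force simp: A_def not_less[symmetric])
    then show "finite {n. walk d U p n = []}" by (rule finite_subset) simp
  qed
qed

section \<open>The initial distribution\<close>

text \<open>
  Shifting the geometric variable by 3, with truncation at 0, puts most of the mass on a single
  particle. This brings the constant in the truncated means down to \<open>101 / 100\<close> and leaves the
  tail as heavy as before.
\<close>

definition frog_pmf :: "nat \<Rightarrow> nat pmf" where
  "frog_pmf d = map_pmf (\<lambda>m. d ^ (m - 3)) (geometric_pmf (1 - 1 / real d))"

lemma set_frog_pmf:
  assumes "d \<ge> 2"
  shows "set_pmf (frog_pmf d) \<subseteq> {1..}"
  using assms by (auto simp: frog_pmf_def)

text \<open>
  The probability of m is of order \<open>d powr (- m)\<close> and the value is of order \<open>d ^ m\<close>, so every m contributes at least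
  a fixed positive constant to the mean.
\<close>

lemma frog_pmf_infinite_mean:
  assumes d: "d \<ge> 2"
  shows "(\<integral>\<^sup>+ k. ennreal (real k) \<partial>measure_pmf (frog_pmf d)) = \<infinity>"
proof -
  define c where "c = (1 / real d) ^ 3 * (1 - 1 / real d)"
  have c: "c > 0" using d by (simp add: c_def)
  have ge: "c \<le> (1 / real d) ^ m * (1 - 1 / real d) * real (d ^ (m - 3))" for m
  proof -
    have "(1 / real d) ^ 3 \<le> (1 / real d) ^ m * real d ^ (m - 3)"
    proof (cases "m \<le> 3")
      case True
      have "(1 / real d) ^ 3 \<le> (1 / real d) ^ m" by (rule power_decreasing[OF True]) (use d in auto)
      then show ?thesis using True by simp
    next
      case False
      then have "m = 3 + (m - 3)" by simp
      then have "(1 / real d) ^ m = (1 / real d) ^ 3 * (1 / real d) ^ (m - 3)"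
        by (metis power_add)
      moreover have "(1 / real d) ^ (m - 3) * real d ^ (m - 3) = 1"
        using d by (simp add: power_one_over)
      ultimately show ?thesis by (simp add: mult.assoc)
    qed
    then have "(1 / real d) ^ 3 * (1 - 1 / real d) \<le> (1 / real d) ^ m * real d ^ (m - 3) * (1 - 1 / real d)"
      by (rule mult_right_mono) (use d in auto)
    then show ?thesis by (simp add: c_def mult_ac)
  qed
  have "(\<integral>\<^sup>+ m. ennreal c \<partial>count_space (UNIV :: nat set))
    \<le> (\<integral>\<^sup>+ m. ennreal (pmf (geometric_pmf (1 - 1 / real d)) m) * ennreal (real (d ^ (m - 3))) \<partial>count_space UNIV)"
    using ge d by (intro nn_integral_mono) (simp add: ennreal_mult[symmetric] ennreal_leI)
  also have "\<dots> = (\<integral>\<^sup>+ k. ennreal (real k) \<partial>measure_pmf (frog_pmf d))"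
    by (simp add: frog_pmf_def nn_integral_measure_pmf[symmetric])
  finally show ?thesis using c by (simp add: top_unique ennreal_mult_top)
qed

lemma hop_base_bounds:
  assumes d: "d \<ge> 14"
  shows "1 / real d \<le> hop_base d" "hop_base d \<le> 1" "hop_base d > 0"
    "1 + (1 - 1 / real d) * (hop_base d ^ 3 / (1 - 1 / (real d * hop_base d))) \<le> 101 / 100"
    "1 / (real d * hop_base d) < 1"
proof -
  define q where "q = sqrt (real d)"
  have dq: "real d = q * q" by (simp add: q_def)
  \<comment> \<open>A lower bound for the square root of 14.\<close>
  have "(374 / 100 :: real) \<le> sqrt (real d)"
    by (rule real_le_rsqrt) (use d in \<open>simp add: power2_eq_square\<close>)
  then have q: "q \<ge> 374 / 100" by (simp add: q_def)
  have b: "hop_base d = 29 / 100 / q" by (simp add: hop_base_def q_def)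
  have db: "real d * hop_base d = 29 / 100 * q" unfolding b dq using q by simp
  show "hop_base d > 0" using b q by simp
  show "1 / real d \<le> hop_base d" using q unfolding b dq by (simp add: field_simps)
  show "hop_base d \<le> 1" using q unfolding b by (simp add: field_simps)
  show lt: "1 / (real d * hop_base d) < 1" using q unfolding db by (simp add: field_simps)
  have "hop_base d ^ 3 / (1 - 1 / (real d * hop_base d)) = (29 / 100) ^ 4 / (q * q * (29 / 100 * q - 1))"
    unfolding db unfolding b using q by (simp add: field_simps power3_eq_cube)
  also have "\<dots> \<le> 1 / 100"
  proof -
    have "(374 / 100) * (374 / 100) \<le> q * q" using q by (intro mult_mono) auto
    then have "(374 / 100) * (374 / 100) * (29 / 100 * (374 / 100) - 1) \<le> q * q * (29 / 100 * q - 1)"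
      using q by (intro mult_mono) auto
    then have "(29 / 100) ^ 4 \<le> 1 / 100 * (q * q * (29 / 100 * q - 1))"
      by (simp add: power4_eq_xxxx)
    moreover have "q * q * (29 / 100 * q - 1) > 0" using q by auto
    ultimately show ?thesis by (simp only: pos_divide_le_eq)
  qed
  finally have le: "hop_base d ^ 3 / (1 - 1 / (real d * hop_base d)) \<le> 1 / 100" .
  have "0 \<le> hop_base d ^ 3 / (1 - 1 / (real d * hop_base d))"
    using lt b q by (intro divide_nonneg_pos) auto
  then have "(1 - 1 / real d) * (hop_base d ^ 3 / (1 - 1 / (real d * hop_base d))) \<le> 1 * (1 / 100)"
    using d le by (intro mult_mono) auto
  then show "1 + (1 - 1 / real d) * (hop_base d ^ 3 / (1 - 1 / (real d * hop_base d))) \<le> 101 / 100"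
    by simp
qed

text \<open>
  For \<open>1 / d \<le> b \<le> 1\<close> one has \<open>min 1 (d ^ n / d ^ j) \<le> b ^ j * (1 / b) ^ n\<close>: the left side is either 1 or a
  power of \<open>1 / d\<close>. Under the geometric tail, \<open>(1 / b) ^ n\<close> has a finite mean precisely because
  \<open>d * b > 1\<close>. This is a fractional moment of order less than 1, which the heavy tail does not spoil.
\<close>

lemma truncated_mean_le:
  assumes d: "d \<ge> 14"
  shows "(\<integral>\<^sup>+ k. ennreal (min 1 (real k * (1 / real d) ^ j)) \<partial>measure_pmf (frog_pmf d))
    \<le> ennreal (101 / 100 * hop_base d ^ j)"
proof -
  define b where "b = hop_base d"
  note b = hop_base_bounds[OF d, folded b_def]
  have pw: "min 1 (real (d ^ n) * (1 / real d) ^ j) \<le> b ^ j * (1 / b) ^ n" for n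
  proof (cases "j \<le> n")
    case True
    then have "b ^ j * (1 / b) ^ n = (1 / b) ^ (n - j)"
      using b by (simp add: power_one_over power_diff)
    also have "\<dots> \<ge> 1" using b by (intro one_le_power) (simp add: field_simps)
    finally show ?thesis by simp
  next
    case False
    then have "real (d ^ n) * (1 / real d) ^ j = (1 / real d) ^ (j - n)"
      using d by (simp add: power_one_over power_diff)
    also have "\<dots> \<le> b ^ (j - n)" using b by (intro power_mono) auto
    also have "\<dots> = b ^ j * (1 / b) ^ n"
      using b False by (simp add: power_one_over power_diff field_simps)
    finally show ?thesis by simp
  qed
  \<comment> \<open>The summand 1 takes care of \<open>m \<le> 3\<close>, the other one of \<open>m > 3\<close>.\<close>
  have pw2: "min 1 (real (d ^ (m - 3)) * (1 / real d) ^ j) \<le> b ^ j * (1 + b ^ 3 * (1 / b) ^ m)" for m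
  proof -
    have "(1 / b) ^ (m - 3) \<le> 1 + b ^ 3 * (1 / b) ^ m"
    proof (cases "m \<le> 3")
      case True
      then show ?thesis using b by simp
    next
      case False
      then show ?thesis using b by (simp add: power_one_over power_diff field_simps)
    qed
    then have "b ^ j * (1 / b) ^ (m - 3) \<le> b ^ j * (1 + b ^ 3 * (1 / b) ^ m)"
      using b by (intro mult_left_mono) auto
    with pw[of "m - 3"] show ?thesis by linarith
  qed
  let ?G = "geometric_pmf (1 - 1 / real d)"
  have "(\<integral>\<^sup>+ k. ennreal (min 1 (real k * (1 / real d) ^ j)) \<partial>measure_pmf (frog_pmf d))
    = (\<integral>\<^sup>+ m. ennreal (min 1 (real (d ^ (m - 3)) * (1 / real d) ^ j)) \<partial>measure_pmf ?G)"
    by (simp add: frog_pmf_def)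
  also have "\<dots> \<le> (\<integral>\<^sup>+ m. ennreal (b ^ j) * (1 + ennreal (b ^ 3 * (1 / b) ^ m)) \<partial>measure_pmf ?G)"
  proof (rule nn_integral_mono)
    fix m
    have "ennreal (min 1 (real (d ^ (m - 3)) * (1 / real d) ^ j)) \<le> ennreal (b ^ j * (1 + b ^ 3 * (1 / b) ^ m))"
      by (rule ennreal_leI) (rule pw2)
    also have "\<dots> = ennreal (b ^ j) * (1 + ennreal (b ^ 3 * (1 / b) ^ m))"
      using b by (subst ennreal_mult) auto
    finally show "ennreal (min 1 (real (d ^ (m - 3)) * (1 / real d) ^ j))
      \<le> ennreal (b ^ j) * (1 + ennreal (b ^ 3 * (1 / b) ^ m))" .
  qed
  also have "\<dots> = ennreal (b ^ j) * (1 + (\<integral>\<^sup>+ m. ennreal (b ^ 3 * (1 / b) ^ m) \<partial>measure_pmf ?G))"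
    by (subst nn_integral_cmult) (auto simp: nn_integral_add)
  also have "(\<integral>\<^sup>+ m. ennreal (b ^ 3 * (1 / b) ^ m) \<partial>measure_pmf ?G)
    = (\<Sum>m. ennreal ((1 - 1 / real d) * (b ^ 3 * (1 / (real d * b)) ^ m)))"
    unfolding nn_integral_measure_pmf nn_integral_count_space_nat
    using d b by (intro suminf_cong) (simp add: ennreal_mult[symmetric] power_divide power_mult_distrib)
  also have "\<dots> = ennreal ((1 - 1 / real d) * (b ^ 3 * (1 / (1 - 1 / (real d * b)))))"
    using d b by (intro suminf_ennreal_eq sums_mult geometric_sums) auto
  also have "ennreal (b ^ j) * (1 + ennreal ((1 - 1 / real d) * (b ^ 3 * (1 / (1 - 1 / (real d * b))))))
    = ennreal (b ^ j * (1 + (1 - 1 / real d) * (b ^ 3 / (1 - 1 / (real d * b)))))"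
  proof -
    have "0 \<le> (1 - 1 / real d) * (b ^ 3 * (1 / (1 - 1 / (real d * b))))"
      using d b by (intro mult_nonneg_nonneg) auto
    then show ?thesis using b by (subst ennreal_mult) (auto simp: ennreal_plus)
  qed
  also have "\<dots> \<le> ennreal (101 / 100 * b ^ j)"
    using b mult_left_mono[OF b(4), of "b ^ j"] by (intro ennreal_leI) (simp add: mult.commute)
  finally show ?thesis unfolding b_def .
qed

section \<open>Paths of hops\<close>

definition hop :: "nat \<Rightarrow> (particle \<times> nat \<Rightarrow> nat) \<Rightarrow> nat list \<Rightarrow> nat \<Rightarrow> nat list \<Rightarrow> bool" where
  "hop d U u N v \<longleftrightarrow> (\<exists>i<N. \<exists>n. walk d U (u, i) n = v)"

definition frogs :: "(nat list \<Rightarrow> nat) \<Rightarrow> nat list \<Rightarrow> nat" where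
  "frogs \<eta> u = (if u = tree_root then 1 else \<eta> u)"

lemma measurable_hop:
  assumes "\<And>i k. ((u, i), k) \<in> K"
  shows "Measurable.pred (PiM K (\<lambda>_. measure_pmf (pmf_of_set {0..d}))) (\<lambda>U. hop d U u N v)"
proof -
  have [measurable]: "(\<lambda>U. walk d U (u, i) n) \<in> measurable (PiM K (\<lambda>_. measure_pmf (pmf_of_set {0..d}))) (count_space UNIV)" for i n
    by (rule measurable_walk) (rule assms)
  show ?thesis unfolding hop_def by measurable
qed

lemma measurable_hop_step_space:
  assumes "u \<in> vertices d"
  shows "Measurable.pred (step_space d) (\<lambda>U. hop d U u N v)"
  unfolding step_space_def by (rule measurable_hop) (use assms in auto)

lemma prob_hop:
  assumes u: "u \<in> vertices d" and v: "v \<in> vertices d" and d: "d \<ge> 1"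
  shows "emeasure (step_space d) {U \<in> space (step_space d). hop d U u N v}
    \<le> ennreal (min 1 (real N * (1 / real d) ^ tree_dist v u))"
proof -
  interpret prob_space "step_space d" by (rule prob_space_step_space)
  let ?A = "\<lambda>i. {U \<in> space (step_space d). \<exists>n. walk d U (u, i) n = v}"
  have [measurable]: "(\<lambda>U. walk d U (u, i) n) \<in> measurable (step_space d) (count_space UNIV)" for i n
    by (rule measurable_walk_step_space) (use u in auto)
  have A: "?A i \<in> sets (step_space d)" for i by measurable
  have "{U \<in> space (step_space d). hop d U u N v} = (\<Union>i<N. ?A i)"
    by (auto simp: hop_def)
  then have "emeasure (step_space d) {U \<in> space (step_space d). hop d U u N v}
    \<le> (\<Sum>i<N. emeasure (step_space d) (?A i))"
    using A by (auto intro!: emeasure_subadditive_finite)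
  also have "\<dots> \<le> (\<Sum>i<N. ennreal ((1 / real d) ^ tree_dist v u))"
  proof (rule sum_mono)
    fix i
    show "emeasure (step_space d) (?A i) \<le> ennreal ((1 / real d) ^ tree_dist v u)"
      using prob_particle_hits[of "(u, i)" d v] u v d by (auto simp: vertices_def)
  qed
  also have "\<dots> = ennreal (real N * (1 / real d) ^ tree_dist v u)"
    by (simp add: ennreal_mult ennreal_of_nat_eq_real_of_nat)
  finally show ?thesis
    using emeasure_le_1[of "{U \<in> space (step_space d). hop d U u N v}"]
    by (simp add: min_def)
qed

text \<open>
  Hops from distinct vertices depend on disjoint blocks of steps.
\<close>

lemma prob_hops_prod:
  assumes dist: "distinct ss" and ss: "set ss \<subseteq> vertices d"
  shows "emeasure (step_space d) {U \<in> space (step_space d). \<forall>i<length ss. hop d U (ss ! i) (N i) (ts ! i)}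
    = (\<Prod>i<length ss. emeasure (step_space d) {U \<in> space (step_space d). hop d U (ss ! i) (N i) (ts ! i)})"
proof -
  interpret prob_space "step_space d" by (rule prob_space_step_space)
  let ?I = "(vertices d \<times> UNIV) \<times> UNIV :: (particle \<times> nat) set"
  let ?M = "\<lambda>_ :: particle \<times> nat. measure_pmf (pmf_of_set {0..d})"
  show ?thesis
  proof (cases "ss = []")
    case True
    then show ?thesis by (simp add: emeasure_space_1)
  next
    case False
    define K :: "nat \<Rightarrow> (particle \<times> nat) set" where "K i = ({ss ! i} \<times> UNIV) \<times> UNIV" for i
    have "indep_vars ?M (\<lambda>j U. U j) ?I"
      unfolding step_space_def by (rule indep_vars_coordinates) (rule prob_space_measure_pmf)
    then have ind: "indep_vars (\<lambda>i. PiM (K i) ?M) (\<lambda>i U. restrict (\<lambda>j. U j) (K i)) {..<length ss}"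
    proof (rule indep_vars_restrict)
      show "K i \<subseteq> ?I" if "i \<in> {..<length ss}" for i
        using that ss nth_mem[of i ss] by (auto simp: K_def)
      show "disjoint_family_on K {..<length ss}"
        using dist by (auto simp: disjoint_family_on_def K_def nth_eq_iff_index_eq)
    qed
    define A where "A i = {V \<in> space (PiM (K i) ?M). hop d V (ss ! i) (N i) (ts ! i)}" for i
    have A: "A i \<in> sets (PiM (K i) ?M)" for i
      unfolding A_def by (intro predE measurable_hop) (simp add: K_def)
    have walk_restrict: "walk d (restrict U (K i)) (ss ! i, j) n = walk d U (ss ! i, j) n" for U i j n
      by (induction n) (auto simp: K_def)
    have vim: "(\<lambda>U. restrict (\<lambda>j. U j) (K i)) -` A i \<inter> space (step_space d)
      = {U \<in> space (step_space d). hop d U (ss ! i) (N i) (ts ! i)}" for i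
      by (auto simp: A_def hop_def walk_restrict space_PiM)
    have "{U \<in> space (step_space d). \<forall>i<length ss. hop d U (ss ! i) (N i) (ts ! i)}
      = (\<Inter>i\<in>{..<length ss}. {U \<in> space (step_space d). hop d U (ss ! i) (N i) (ts ! i)})"
      using False by auto
    then have "prob {U \<in> space (step_space d). \<forall>i<length ss. hop d U (ss ! i) (N i) (ts ! i)}
      = (\<Prod>i<length ss. prob {U \<in> space (step_space d). hop d U (ss ! i) (N i) (ts ! i)})"
      using indep_varsD[OF ind, of "{..<length ss}" A] A False by (simp only: vim) auto
    then show ?thesis
      by (simp add: emeasure_eq_measure prod_ennreal)
  qed
qed

definition config_space :: "nat \<Rightarrow> (nat list \<Rightarrow> nat) measure" where
  "config_space d = (\<Pi>\<^sub>M v\<in>vertices d. measure_pmf (frog_pmf d))"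

lemma prob_space_config_space: "prob_space (config_space d)"
  unfolding config_space_def by (intro prob_space_PiM) (rule prob_space_measure_pmf)

lemma frog_space_eq: "frog_space d (frog_pmf d) = config_space d \<Otimes>\<^sub>M step_space d"
  by (simp add: frog_space_def config_space_def step_space_def)

text \<open>
  Distinct vertices carry independent numbers of particles, so the hop bounds of a self-avoiding path can be
  averaged one by one.
\<close>

lemma integral_config_prod:
  fixes g :: "nat \<Rightarrow> nat \<Rightarrow> ennreal"
  assumes dist: "distinct ss" and ss: "set ss \<subseteq> vertices d"
  shows "(\<integral>\<^sup>+ \<eta>. (\<Prod>i<length ss. g i (\<eta> (ss ! i))) \<partial>config_space d)
    = (\<Prod>i<length ss. \<integral>\<^sup>+ k. g i k \<partial>measure_pmf (frog_pmf d))"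
proof -
  interpret prob_space "config_space d" by (rule prob_space_config_space)
  let ?M = "\<lambda>_ :: nat list. measure_pmf (frog_pmf d)"
  have v: "ss ! i \<in> vertices d" if "i < length ss" for i using that ss nth_mem by blast
  have "indep_vars ?M (\<lambda>v \<eta>. \<eta> v) (vertices d)"
    unfolding config_space_def by (rule indep_vars_coordinates) (rule prob_space_measure_pmf)
  then have ind: "indep_vars (\<lambda>i. PiM {ss ! i} ?M) (\<lambda>i \<eta>. restrict (\<lambda>v. \<eta> v) {ss ! i}) {..<length ss}"
  proof (rule indep_vars_restrict)
    show "{ss ! i} \<subseteq> vertices d" if "i \<in> {..<length ss}" for i using that v by auto
    show "disjoint_family_on (\<lambda>i. {ss ! i}) {..<length ss}"
      using dist by (auto simp: disjoint_family_on_def nth_eq_iff_index_eq)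
  qed
  have "indep_vars (\<lambda>_. borel) (\<lambda>i \<eta>. g i (restrict (\<lambda>v. \<eta> v) {ss ! i} (ss ! i))) {..<length ss}"
  proof (rule indep_vars_compose2[OF ind])
    fix i
    have "(\<lambda>\<eta>. \<eta> (ss ! i)) \<in> measurable (PiM {ss ! i} ?M) (measure_pmf (frog_pmf d))"
      by (rule measurable_component_singleton) simp
    then show "(\<lambda>\<eta>. g i (\<eta> (ss ! i))) \<in> borel_measurable (PiM {ss ! i} ?M)"
      by (rule measurable_compose) simp
  qed
  from indep_vars_nn_integral[OF _ this]
  have "(\<integral>\<^sup>+ \<eta>. (\<Prod>i<length ss. g i (\<eta> (ss ! i))) \<partial>config_space d)
    = (\<Prod>i<length ss. \<integral>\<^sup>+ \<eta>. g i (\<eta> (ss ! i)) \<partial>config_space d)"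
    by simp
  also have "\<dots> = (\<Prod>i<length ss. \<integral>\<^sup>+ k. g i k \<partial>measure_pmf (frog_pmf d))"
  proof (intro prod.cong refl)
    fix i assume "i \<in> {..<length ss}"
    then have vi: "ss ! i \<in> vertices d" using v by auto
    have "(\<integral>\<^sup>+ k. g i k \<partial>measure_pmf (frog_pmf d))
      = (\<integral>\<^sup>+ k. g i k \<partial>distr (config_space d) (measure_pmf (frog_pmf d)) (\<lambda>\<eta>. \<eta> (ss ! i)))"
      unfolding config_space_def
      by (subst distr_PiM_component[OF _ vi]) (auto intro: prob_space_measure_pmf)
    also have "\<dots> = (\<integral>\<^sup>+ \<eta>. g i (\<eta> (ss ! i)) \<partial>config_space d)"
    proof (rule nn_integral_distr)
      show "(\<lambda>\<eta>. \<eta> (ss ! i)) \<in> measurable (config_space d) (measure_pmf (frog_pmf d))"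
        unfolding config_space_def by (rule measurable_component_singleton) (rule vi)
    qed simp
    finally show "(\<integral>\<^sup>+ \<eta>. g i (\<eta> (ss ! i)) \<partial>config_space d) = (\<integral>\<^sup>+ k. g i k \<partial>measure_pmf (frog_pmf d))" ..
  qed
  finally show ?thesis .
qed

text \<open>
  Source number i of the path is \<open>(tree_root # xs) ! i\<close> and the hop from it leads to \<open>(xs @ [tree_root]) ! i\<close>, so
  that the last hop returns to the root. The empty list stands for the initial particle, which is at the
  root at time 0.
\<close>

definition closed_path ::
  "nat \<Rightarrow> (nat list \<Rightarrow> nat) \<Rightarrow> (particle \<times> nat \<Rightarrow> nat) \<Rightarrow> nat list list \<Rightarrow> bool" where
  "closed_path d \<eta> U xs \<longleftrightarrow> (\<forall>i<length (tree_root # xs).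
     hop d U ((tree_root # xs) ! i) (frogs \<eta> ((tree_root # xs) ! i)) ((xs @ [tree_root]) ! i))"

lemma measurable_closed_path:
  assumes "set xs \<subseteq> vertices d"
  shows "Measurable.pred (config_space d \<Otimes>\<^sub>M step_space d) (\<lambda>(\<eta>, U). closed_path d \<eta> U xs)"
proof -
  let ?ss = "tree_root # xs"
  have ss: "?ss ! i \<in> vertices d" if "i < length ?ss" for i
    using assms nth_mem[OF that] by (auto simp: vertices_def)
  have "Measurable.pred (config_space d \<Otimes>\<^sub>M step_space d)
      (\<lambda>(\<eta>, U). hop d U (?ss ! i) (frogs \<eta> (?ss ! i)) ((xs @ [tree_root]) ! i))" if "i < length ?ss" for i
  proof -
    have [measurable]: "(\<lambda>\<eta>. frogs \<eta> (?ss ! i)) \<in> measurable (config_space d) (count_space UNIV)"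
    proof -
      have "(\<lambda>\<eta>. \<eta> (?ss ! i)) \<in> measurable (config_space d) (measure_pmf (frog_pmf d))"
        unfolding config_space_def by (rule measurable_component_singleton) (rule ss[OF that])
      then show ?thesis unfolding frogs_def by simp
    qed
    have [measurable]: "Measurable.pred (step_space d) (\<lambda>U. hop d U (?ss ! i) N ((xs @ [tree_root]) ! i))" for N
      by (rule measurable_hop_step_space) (rule ss[OF that])
    have "Measurable.pred (config_space d \<Otimes>\<^sub>M step_space d)
      (\<lambda>p. hop d (snd p) (?ss ! i) (frogs (fst p) (?ss ! i)) ((xs @ [tree_root]) ! i))"
      by (rule measurable_compose_countable[where f = "\<lambda>N p. hop d (snd p) (?ss ! i) N ((xs @ [tree_root]) ! i)"
          and g = "\<lambda>p. frogs (fst p) (?ss ! i)"]) measurable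
    then show ?thesis by (simp add: case_prod_unfold)
  qed
  note m = this
  have "Measurable.pred (config_space d \<Otimes>\<^sub>M step_space d)
      (\<lambda>p. \<forall>i\<in>{..<length ?ss}. case p of (\<eta>, U) \<Rightarrow> hop d U (?ss ! i) (frogs \<eta> (?ss ! i)) ((xs @ [tree_root]) ! i))"
    by (intro pred_intros_finite) (use m in auto)
  then show ?thesis unfolding closed_path_def case_prod_unfold Ball_def lessThan_iff .
qed

primrec path_weight :: "nat \<Rightarrow> nat list \<Rightarrow> nat list list \<Rightarrow> ennreal" where
  "path_weight d u [] = ennreal (101 / 100 * hop_base d ^ tree_dist tree_root u)"
| "path_weight d u (x # xs) = ennreal (101 / 100 * hop_base d ^ tree_dist x u) * path_weight d x xs"

lemma path_weight_eq_prod: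
  "(\<Prod>i<length (u # xs). ennreal (101 / 100 * hop_base d ^ tree_dist ((xs @ [tree_root]) ! i) ((u # xs) ! i)))
    = path_weight d u xs"
proof (induction xs arbitrary: u)
  case Nil
  then show ?case by simp
next
  case (Cons x xs)
  show ?case
    unfolding list.size(4) Nat.add_0_right add_Suc_right One_nat_def prod.lessThan_Suc_shift
    using Cons[of x] by (simp add: prod.lessThan_Suc_shift del: prod.lessThan_Suc)
qed

text \<open>
  For fixed \<open>\<eta>\<close> the hops are independent. The resulting product of truncated numbers of particles is then
  integrated over \<open>\<eta>\<close>; truncating at 1 before this integration is what keeps it finite.
\<close>

lemma prob_closed_path:
  assumes d: "d \<ge> 14" and xs: "set xs \<subseteq> vertices d" and dist: "distinct (tree_root # xs)"
  shows "emeasure (config_space d \<Otimes>\<^sub>M step_space d)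
      {p \<in> space (config_space d \<Otimes>\<^sub>M step_space d). case p of (\<eta>, U) \<Rightarrow> closed_path d \<eta> U xs}
    \<le> path_weight d tree_root xs"
proof -
  interpret S: prob_space "step_space d" by (rule prob_space_step_space)
  interpret E: prob_space "config_space d" by (rule prob_space_config_space)
  let ?ss = "tree_root # xs" and ?ts = "xs @ [tree_root]"
  let ?P = "{p \<in> space (config_space d \<Otimes>\<^sub>M step_space d). case p of (\<eta>, U) \<Rightarrow> closed_path d \<eta> U xs}"
  define D where "D i = tree_dist (?ts ! i) (?ss ! i)" for i
  define g where "g i k = ennreal (min 1 (real (if ?ss ! i = tree_root then 1 else k) * (1 / real d) ^ D i))" for i k
  have ss: "set ?ss \<subseteq> vertices d" using xs by (auto simp: vertices_def)
  have ts: "set ?ts \<subseteq> vertices d" using ss by auto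
  have len: "length ?ts = length ?ss" by simp
  have P: "?P \<in> sets (config_space d \<Otimes>\<^sub>M step_space d)"
    by (rule predE) (rule measurable_closed_path[OF xs])
  have "emeasure (config_space d \<Otimes>\<^sub>M step_space d) ?P
    = (\<integral>\<^sup>+ \<eta>. emeasure (step_space d) (Pair \<eta> -` ?P) \<partial>config_space d)"
    by (rule S.emeasure_pair_measure_alt[OF P])
  also have "\<dots> \<le> (\<integral>\<^sup>+ \<eta>. (\<Prod>i<length ?ss. g i (\<eta> (?ss ! i))) \<partial>config_space d)"
  proof (rule nn_integral_mono)
    fix \<eta> assume "\<eta> \<in> space (config_space d)"
    then have "Pair \<eta> -` ?P = {U \<in> space (step_space d). \<forall>i<length ?ss. hop d U (?ss ! i) (frogs \<eta> (?ss ! i)) (?ts ! i)}"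
      by (auto simp: space_pair_measure closed_path_def)
    then have "emeasure (step_space d) (Pair \<eta> -` ?P)
      = (\<Prod>i<length ?ss. emeasure (step_space d) {U \<in> space (step_space d). hop d U (?ss ! i) (frogs \<eta> (?ss ! i)) (?ts ! i)})"
      by (simp only: prob_hops_prod[OF dist ss])
    also have "\<dots> \<le> (\<Prod>i<length ?ss. g i (\<eta> (?ss ! i)))"
    proof (rule prod_mono_ennreal)
      fix i assume "i \<in> {..<length ?ss}"
      then have i: "i < length ?ss" by simp
      have "emeasure (step_space d) {U \<in> space (step_space d). hop d U (?ss ! i) (frogs \<eta> (?ss ! i)) (?ts ! i)}
        \<le> ennreal (min 1 (real (frogs \<eta> (?ss ! i)) * (1 / real d) ^ tree_dist (?ts ! i) (?ss ! i)))"
      proof (rule prob_hop)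
        show "?ss ! i \<in> vertices d" using ss nth_mem[OF i] by blast
        show "?ts ! i \<in> vertices d" using ts nth_mem[of i ?ts] i by auto
      qed (use d in auto)
      also have "\<dots> = g i (\<eta> (?ss ! i))" by (simp only: g_def D_def frogs_def)
      finally show "emeasure (step_space d) {U \<in> space (step_space d). hop d U (?ss ! i) (frogs \<eta> (?ss ! i)) (?ts ! i)}
        \<le> g i (\<eta> (?ss ! i))" .
    qed
    finally show "emeasure (step_space d) (Pair \<eta> -` ?P) \<le> (\<Prod>i<length ?ss. g i (\<eta> (?ss ! i)))" .
  qed
  also have "\<dots> = (\<Prod>i<length ?ss. \<integral>\<^sup>+ k. g i k \<partial>measure_pmf (frog_pmf d))"
    by (rule integral_config_prod[OF dist ss])
  also have "\<dots> \<le> (\<Prod>i<length ?ss. ennreal (101 / 100 * hop_base d ^ D i))"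
  proof (rule prod_mono_ennreal)
    fix i
    show "(\<integral>\<^sup>+ k. g i k \<partial>measure_pmf (frog_pmf d)) \<le> ennreal (101 / 100 * hop_base d ^ D i)"
    proof (cases "?ss ! i = tree_root")
      case True
      note b = hop_base_bounds[OF d]
      have "(1 / real d) ^ D i \<le> hop_base d ^ D i" using b by (intro power_mono) auto
      also have "\<dots> \<le> 101 / 100 * hop_base d ^ D i" using b by simp
      finally have "min 1 ((1 / real d) ^ D i) \<le> 101 / 100 * hop_base d ^ D i" by simp
      then show ?thesis using True by (simp add: g_def measure_pmf.emeasure_space_1 ennreal_leI)
    next
      case False
      then show ?thesis using truncated_mean_le[OF d, of "D i"] by (simp add: g_def)
    qed
  qed
  also have "\<dots> = path_weight d tree_root xs"
    unfolding D_def by (rule path_weight_eq_prod)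
  finally show ?thesis .
qed

text \<open>
  Excluding \<open>v = u\<close> from the sum of \<open>hop_weight_sum_le\<close> lowers the factor \<open>10000 / 5041\<close> by 1. The remaining
  factor \<open>(101 / 100) * (4959 / 5041)\<close> per hop is less than 1, so \<open>path_sum_le\<close> applies. The final hop to the
  root is absorbed by \<open>b \<le> r\<close>.
\<close>

lemma sum_path_weight_finite:
  assumes d: "d \<ge> 14"
  shows "(\<integral>\<^sup>+ xs. path_weight d tree_root xs
      * indicator {xs. set xs \<subseteq> vertices d \<and> distinct (tree_root # xs)} xs \<partial>count_space UNIV) < \<infinity>"
proof -
  let ?b = "hop_base d" and ?r = "level_weight d"
  define h where "h u = ennreal (?r ^ length u)" for u :: "nat list"
  define w where "w u x = ennreal (101 / 100 * ?b ^ tree_dist x u)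
      * indicator {x. u \<in> vertices d \<and> x \<in> vertices d - {u}} x" for u x
  define W where "W u xs = path_weight d u xs
      * indicator {xs. set (u # xs) \<subseteq> vertices d \<and> distinct (u # xs)} xs" for u xs
  have b0: "?b > 0" and r0: "?r \<ge> 0" using hop_base_bounds[OF d] by (auto simp: level_weight_def)
  have br: "?b \<le> ?r" using divide_right_mono[of "29 / 100" 1 "sqrt (real d)"]
    by (simp add: hop_base_def level_weight_def)
  have contr: "(\<integral>\<^sup>+ x. w u x * h x \<partial>count_space UNIV) \<le> ennreal (101 / 100 * (4959 / 5041)) * h u" for u
  proof (cases "u \<in> vertices d")
    case False
    then show ?thesis by (simp add: w_def)
  next
    case u: True
    let ?f = "\<lambda>v. ennreal (?b ^ tree_dist v u * ?r ^ length v)"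
    have "(\<integral>\<^sup>+ v. ?f v * indicator (vertices d - {u}) v \<partial>count_space UNIV) + h u
      = (\<integral>\<^sup>+ v. ?f v * indicator (vertices d - {u}) v \<partial>count_space UNIV)
        + (\<integral>\<^sup>+ v. ?f v * indicator {u} v \<partial>count_space UNIV)"
      by (simp add: nn_integral_count_space_indicator[symmetric] nn_integral_count_space_finite h_def)
    also have "\<dots> = (\<integral>\<^sup>+ v. ?f v * indicator (vertices d - {u}) v + ?f v * indicator {u} v \<partial>count_space UNIV)"
      by (rule nn_integral_add[symmetric]) auto
    also have "\<dots> = (\<integral>\<^sup>+ v. ?f v * indicator (vertices d) v \<partial>count_space UNIV)"
      using u by (intro nn_integral_cong) (auto split: split_indicator)
    also have "\<dots> \<le> ennreal (10000 / 5041) * h u" unfolding h_def by (rule hop_weight_sum_le[OF d])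
    also have "\<dots> = ennreal (4959 / 5041) * h u + h u"
      using r0 by (simp add: h_def ennreal_mult[symmetric] ennreal_plus[symmetric] del: ennreal_plus)
    finally have "(\<integral>\<^sup>+ v. ?f v * indicator (vertices d - {u}) v \<partial>count_space UNIV) \<le> ennreal (4959 / 5041) * h u"
      by (subst (asm) (1 2) add.commute, subst (asm) ennreal_add_left_cancel_le) (auto simp: h_def)
    moreover have "w u x * h x = ennreal (101 / 100) * (?f x * indicator (vertices d - {u}) x)" for x
      using u b0 r0 by (cases "x \<in> vertices d - {u}")
        (auto simp: w_def h_def ennreal_mult[symmetric] mult.assoc)
    then have "(\<integral>\<^sup>+ x. w u x * h x \<partial>count_space UNIV)
      = ennreal (101 / 100) * (\<integral>\<^sup>+ v. ?f v * indicator (vertices d - {u}) v \<partial>count_space UNIV)"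
      by (simp add: nn_integral_cmult)
    moreover have "ennreal (101 / 100 * (4959 / 5041)) = ennreal (101 / 100) * ennreal (4959 / 5041)"
      by (rule ennreal_mult) auto
    ultimately show ?thesis
      by (simp only: mult.assoc) (auto intro: mult_left_mono)
  qed
  have "(\<integral>\<^sup>+ xs. W tree_root xs \<partial>count_space UNIV) \<le> ennreal 200 * h tree_root"
  proof (rule path_sum_le[where W = W and w = w and a = "ennreal (101 / 100)", OF _ _ contr])
    fix u :: "nat list"
    have "?b ^ length u \<le> ?r ^ length u" using b0 br by (intro power_mono) auto
    then have "path_weight d u [] \<le> ennreal (101 / 100) * h u"
      using r0 by (simp add: h_def tree_dist_root ennreal_mult[symmetric] ennreal_leI)
    then show "W u [] \<le> ennreal (101 / 100) * h u"
      by (auto simp: W_def split: split_indicator)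
    show "W u (x # xs) \<le> w u x * W x xs" for x xs
      by (auto simp: W_def w_def split: split_indicator)
    have sum: "ennreal (101 / 100) + ennreal l * ennreal 200 = ennreal (101 / 100 + l * 200)"
      if "0 \<le> l" for l
      using that by (simp add: ennreal_mult)
    \<comment> \<open>The least C with \<open>101 / 100 + l * C \<le> C\<close> for this contraction factor l is about 157.\<close>
    show "ennreal (101 / 100) + ennreal (101 / 100 * (4959 / 5041)) * ennreal 200 \<le> ennreal 200"
      by (subst sum, simp, rule ennreal_leI, simp)
  qed
  also have "\<dots> < \<infinity>" by (simp add: h_def ennreal_mult_less_top)
  finally show ?thesis by (simp add: W_def vertices_def)
qed

section \<open>Finitely many closed paths\<close>

lemma AE_snd:
  assumes "prob_space E" "prob_space S" and "AE U in S. Q U"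
  shows "AE (\<eta>, U) in E \<Otimes>\<^sub>M S. Q U"
proof -
  interpret E: prob_space E by fact
  interpret S: prob_space S by fact
  obtain N where N: "N \<in> null_sets S" "{U \<in> space S. \<not> Q U} \<subseteq> N"
    using assms(3) by (auto simp: eventually_ae_filter)
  have "space E \<times> N \<in> null_sets (E \<Otimes>\<^sub>M S)"
    using N(1) by (auto simp: null_sets_def S.emeasure_pair_measure_Times)
  then show ?thesis
    by (rule AE_I') (use N(2) in \<open>auto simp: space_pair_measure\<close>)
qed

text \<open>
  The expected number of realised paths is finite, hence so is almost surely their number.
\<close>

lemma AE_finite_closed_paths:
  assumes d: "d \<ge> 14"
  shows "AE (\<eta>, U) in frog_space d (frog_pmf d).
    finite {xs. set xs \<subseteq> vertices d \<and> distinct (tree_root # xs) \<and> closed_path d \<eta> U xs}"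
proof -
  let ?F = "config_space d \<Otimes>\<^sub>M step_space d"
  define P where "P = {xs. set xs \<subseteq> vertices d \<and> distinct (tree_root # xs)}"
  define A where "A xs = (if xs \<in> P then {p \<in> space ?F. case p of (\<eta>, U) \<Rightarrow> closed_path d \<eta> U xs} else {})" for xs
  have A [measurable]: "A xs \<in> sets ?F" for xs
    unfolding A_def P_def by (auto intro!: predE measurable_closed_path)
  have "(\<integral>\<^sup>+ p. \<integral>\<^sup>+ xs. indicator (A xs) p \<partial>count_space UNIV \<partial>?F)
    = (\<integral>\<^sup>+ xs. \<integral>\<^sup>+ p. indicator (A xs) p \<partial>?F \<partial>count_space UNIV)"
    by (rule nn_integral_count_space_nn_integral) auto
  also have "\<dots> \<le> (\<integral>\<^sup>+ xs. path_weight d tree_root xs * indicator P xs \<partial>count_space UNIV)"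
  proof (rule nn_integral_mono)
    fix xs
    have "emeasure ?F (A xs) \<le> path_weight d tree_root xs * indicator P xs"
      using prob_closed_path[OF d, of xs] by (auto simp: A_def P_def split: split_indicator)
    then show "(\<integral>\<^sup>+ p. indicator (A xs) p \<partial>?F) \<le> path_weight d tree_root xs * indicator P xs"
      by simp
  qed
  also have "\<dots> < \<infinity>" unfolding P_def by (rule sum_path_weight_finite[OF d])
  finally have fin: "(\<integral>\<^sup>+ p. \<integral>\<^sup>+ xs. indicator (A xs) p \<partial>count_space UNIV \<partial>?F) \<noteq> \<infinity>" by simp
  have "AE p in ?F. (\<integral>\<^sup>+ xs. indicator (A xs) p \<partial>count_space UNIV) \<noteq> \<infinity>"
  proof (rule nn_integral_PInf_AE[OF _ fin])
    show "(\<lambda>p. \<integral>\<^sup>+ xs. indicator (A xs) p \<partial>count_space UNIV) \<in> borel_measurable ?F"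
    proof -
      have bij: "bij_betw (from_nat_into (UNIV :: nat list list set)) UNIV UNIV"
        by (rule bij_betw_from_nat_into) (auto simp: infinite_UNIV_listI)
      have "(\<integral>\<^sup>+ xs. indicator (A xs) p \<partial>count_space UNIV)
        = (\<Sum>n. indicator (A (from_nat_into UNIV n)) p :: ennreal)" for p
        by (subst nn_integral_bij_count_space[OF bij, symmetric]) (rule nn_integral_count_space_nat)
      then show ?thesis by simp
    qed
  qed
  then show ?thesis unfolding frog_space_eq
  proof (rule AE_mp, intro AE_I2 impI)
    fix p assume p: "p \<in> space ?F" and ne: "(\<integral>\<^sup>+ xs. indicator (A xs) p \<partial>count_space UNIV) \<noteq> \<infinity>"
    have "(\<integral>\<^sup>+ xs. indicator (A xs) p \<partial>count_space UNIV)
      = (\<integral>\<^sup>+ xs. indicator {xs. p \<in> A xs} xs \<partial>count_space UNIV)"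
      by (intro nn_integral_cong) (auto split: split_indicator)
    also have "\<dots> = emeasure (count_space UNIV) {xs. p \<in> A xs}" by simp
    finally have "finite {xs. p \<in> A xs}" using ne by (auto simp: emeasure_count_space split: if_splits)
    moreover have "{xs. p \<in> A xs} = {xs. set xs \<subseteq> vertices d \<and> distinct (tree_root # xs) \<and> closed_path d (fst p) (snd p) xs}"
      using p by (auto simp: A_def P_def split: if_splits)
    ultimately show "case p of (\<eta>, U) \<Rightarrow> finite {xs. set xs \<subseteq> vertices d \<and> distinct (tree_root # xs) \<and> closed_path d \<eta> U xs}"
      by (simp add: case_prod_unfold)
  qed
qed

section \<open>Visits to the root\<close>

lemma walk_in_vertices:
  assumes U: "\<forall>j\<in>(vertices d \<times> UNIV) \<times> UNIV. U j \<le> d" and p: "p \<in> vertices d \<times> UNIV"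
  shows "walk d U p n \<in> vertices d"
proof (induction n)
  case 0
  then show ?case using p by auto
next
  case (Suc n)
  have "U (p, n) \<le> d" using U p by blast
  then have "U (p, n) \<in> {0..d}" by simp
  then have "neighbour d (walk d U p n) (U (p, n)) \<in> neighbours d (walk d U p n)"
    using bij_betw_neighbour[OF Suc] by (auto simp: bij_betw_def)
  then show ?case by (simp add: neighbours_def)
qed

text \<open>
  The order in which particles wake up disappears here: whether a vertex is ever woken up is a question of
  reachability by hops, which can be read off the walks without reference to time.
\<close>

lemma active_reachable:
  assumes U: "\<forall>j\<in>(vertices d \<times> UNIV) \<times> UNIV. U j \<le> d"
    and p: "p \<in> active d \<eta> U t"
  shows "fst p \<in> vertices d \<and> snd p < frogs \<eta> (fst p)
    \<and> (\<lambda>u v. v \<in> vertices d \<and> hop d U u (frogs \<eta> u) v)\<^sup>*\<^sup>* tree_root (fst p)"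
  using p
proof (induction t arbitrary: p)
  case 0
  then show ?case by (auto simp: active_def frogs_def vertices_def)
next
  case (Suc t)
  let ?R = "\<lambda>u v. v \<in> vertices d \<and> hop d U u (frogs \<eta> u) v"
  let ?A = "active d \<eta> U t"
  show ?case
  proof (cases "p \<in> ?A")
    case True
    then show ?thesis by (rule Suc.IH)
  next
    case False
    with Suc.prems have "fst p \<noteq> tree_root \<and> snd p < \<eta> (fst p) \<and> (\<exists>q\<in>?A.
        walk d U q (if q \<in> ?A then Suc (snd (frog_state d \<eta> U t) q) else snd (frog_state d \<eta> U t) q) = fst p)"
      unfolding active_def frog_state.simps Let_def fst_conv by (auto simp del: walk.simps)
    then obtain q n where q: "q \<in> ?A" "walk d U q n = fst p"
      and p: "fst p \<noteq> tree_root" "snd p < \<eta> (fst p)"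
      by blast
    note IH = Suc.IH[OF q(1)]
    then have "q \<in> vertices d \<times> UNIV" by (cases q) auto
    from walk_in_vertices[OF U this, of n] have v: "fst p \<in> vertices d" using q by simp
    have "hop d U (fst q) (frogs \<eta> (fst q)) (fst p)"
      unfolding hop_def using IH q(2) by (intro exI[of _ "snd q"]) auto
    then have "?R (fst q) (fst p)" using v by simp
    then have "?R\<^sup>*\<^sup>* tree_root (fst p)" 
      by (rule rtranclp.rtrancl_into_rtrancl[OF conjunct2[OF conjunct2[OF IH]]])
    then show ?thesis using p v by (auto simp: frogs_def)
  qed
qed

text \<open>
  Reachability gives some path of hops; its loops are removed because only paths with distinct sources
  have independent hops.
\<close>

lemma closed_path_through:
  assumes reach: "(\<lambda>u v. v \<in> vertices d \<and> hop d U u (frogs \<eta> u) v)\<^sup>*\<^sup>* tree_root v"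
    and homeward: "hop d U v (frogs \<eta> v) tree_root"
  obtains xs where "set xs \<subseteq> vertices d" "distinct (tree_root # xs)" "closed_path d \<eta> U xs"
    "last (tree_root # xs) = v"
proof -
  let ?R = "\<lambda>u v. v \<in> vertices d \<and> hop d U u (frogs \<eta> u) v"
  from reach obtain ys where "rtrancl_path ?R tree_root ys v"
    unfolding rtranclp_eq_rtrancl_path by blast
  then obtain xs where xs: "rtrancl_path ?R tree_root xs v" and dist: "distinct (tree_root # xs)"
    by (rule rtrancl_path_distinct)
  have step: "?R ((tree_root # xs) ! i) (xs ! i)" if "i < length xs" for i
    using rtrancl_path_nth[OF xs that] .
  have last: "last (tree_root # xs) = v"
  proof (cases xs)
    case Nil
    with xs show ?thesis by (auto elim: rtrancl_path.cases)
  next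
    case (Cons a list)
    then show ?thesis using rtrancl_path_last[OF xs] by simp
  qed
  have "closed_path d \<eta> U xs"
    unfolding closed_path_def
  proof (intro allI impI)
    fix i assume "i < length (tree_root # xs)"
    then consider "i < length xs" | "i = length xs" by fastforce
    then show "hop d U ((tree_root # xs) ! i) (frogs \<eta> ((tree_root # xs) ! i)) ((xs @ [tree_root]) ! i)"
    proof cases
      case 1
      then show ?thesis using step[of i] by (simp add: nth_append)
    next
      case 2
      then have "(tree_root # xs) ! i = v" using last by (simp add: last_conv_nth split: if_splits)
      then show ?thesis using homeward 2 by (simp only: nth_append_length)
    qed
  qed
  moreover have "set xs \<subseteq> vertices d" using step by (auto simp: in_set_conv_nth)
  ultimately show ?thesis using that dist last by blast
qed

lemma steps_taken_after:
  assumes "p \<in> active d \<eta> U t"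
  shows "p \<in> active d \<eta> U (t + k) \<and> snd (frog_state d \<eta> U (t + k)) p = snd (frog_state d \<eta> U t) p + k"
  using assms by (induction k) (auto simp: active_def Let_def)

text \<open>
  A particle that visits the root determines a closed path through its starting vertex, and each vertex
  has finitely many particles. For one particle, distinct visiting times are distinct step numbers of its
  walk, since an active particle moves at every time.
\<close>

lemma transient_if_finite:
  assumes U: "\<forall>j\<in>(vertices d \<times> UNIV) \<times> UNIV. U j \<le> d"
    and ret: "\<forall>p\<in>vertices d \<times> UNIV. finite {n. walk d U p n = tree_root}"
    and paths: "finite {xs. set xs \<subseteq> vertices d \<and> distinct (tree_root # xs) \<and> closed_path d \<eta> U xs}"
  shows "transient d \<eta> U"
proof -
  let ?X = "{xs. set xs \<subseteq> vertices d \<and> distinct (tree_root # xs) \<and> closed_path d \<eta> U xs}"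
  let ?steps = "\<lambda>t. snd (frog_state d \<eta> U t)"
  define V where "V = (\<lambda>xs. last (tree_root # xs)) ` ?X"
  define T where "T p = {t. p \<in> active d \<eta> U t \<and> location d \<eta> U t p = tree_root}" for p
  have "root_visits d \<eta> U \<subseteq> (SIGMA p:(SIGMA v:V. {..<frogs \<eta> v}). T p)"
  proof
    fix z assume z: "z \<in> root_visits d \<eta> U"
    obtain v i t where z_eq: "z = ((v, i), t)" by (metis surj_pair)
    with z have act: "(v, i) \<in> active d \<eta> U t" and loc: "walk d U (v, i) (?steps t (v, i)) = tree_root"
      by (auto simp: root_visits_def location_def)
    note r = active_reachable[OF U act, simplified]
    have "hop d U v (frogs \<eta> v) tree_root" unfolding hop_def using r loc by blast
    with r obtain xs where "set xs \<subseteq> vertices d" "distinct (tree_root # xs)" "closed_path d \<eta> U xs"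
      "last (tree_root # xs) = v" using closed_path_through by blast
    then have "v \<in> V" unfolding V_def by blast
    then show "z \<in> (SIGMA p:(SIGMA v:V. {..<frogs \<eta> v}). T p)"
      using r act loc z_eq by (auto simp: T_def location_def)
  qed
  moreover have "finite (T p)" for p
  proof (cases "T p = {}")
    case False
    then have "p \<in> vertices d \<times> UNIV" using active_reachable[OF U] by (cases p) (force simp: T_def)
    then have fin: "finite {n. walk d U p n = tree_root}" using ret by blast
    have "inj_on (\<lambda>t. ?steps t p) (T p)"
    proof (rule linorder_inj_onI')
      fix s t assume "s \<in> T p" "t \<in> T p" "s < t"
      then show "?steps s p \<noteq> ?steps t p"
        using steps_taken_after[of p d \<eta> U s "t - s"] by (auto simp: T_def)
    qed
    moreover have "(\<lambda>t. ?steps t p) ` T p \<subseteq> {n. walk d U p n = tree_root}"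
      by (auto simp: T_def location_def)
    ultimately show ?thesis using fin by (meson finite_imageD finite_subset)
  qed auto
  moreover have "finite (SIGMA v:V. {..<frogs \<eta> v})" using paths by (auto simp: V_def)
  ultimately have "finite (root_visits d \<eta> U)" by (meson finite_SigmaI finite_subset)
  then show ?thesis by (simp add: transient_def recurrent_def)
qed

theorem mainTheorem3:
  fixes d :: nat
  assumes "d \<ge> 14"
  shows "\<exists>\<pi> :: nat pmf.
    set_pmf \<pi> \<subseteq> {1..} \<and>
    (\<integral>\<^sup>+ k. ennreal (real k) \<partial>measure_pmf \<pi>) = \<infinity> \<and>
    (AE (\<eta>, U) in frog_space d \<pi>. transient d \<eta> U)"
proof (intro exI conjI)
  show "set_pmf (frog_pmf d) \<subseteq> {1..}" by (rule set_frog_pmf) (use assms in simp)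
  show "(\<integral>\<^sup>+ k. ennreal (real k) \<partial>measure_pmf (frog_pmf d)) = \<infinity>"
    by (rule frog_pmf_infinite_mean) (use assms in simp)
  have "AE U in step_space d. \<forall>p\<in>vertices d \<times> UNIV. finite {n. walk d U p n = tree_root}"
    by (subst AE_ball_countable) (use AE_finite_returns assms in auto)
  with AE_steps_le have "AE U in step_space d. (\<forall>j\<in>(vertices d \<times> UNIV) \<times> UNIV. U j \<le> d)
      \<and> (\<forall>p\<in>vertices d \<times> UNIV. finite {n. walk d U p n = tree_root})"
    by eventually_elim blast
  from AE_snd[OF prob_space_config_space prob_space_step_space this] AE_finite_closed_paths[OF assms]
  show "AE (\<eta>, U) in frog_space d (frog_pmf d). transient d \<eta> U"
    unfolding frog_space_eq by eventually_elim (auto intro: transient_if_finite)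
qed

end
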